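(* The maps $\psi_V:\mathrm{T}[V]\to\mathrm{T}^{\bullet}[V]$, defined for every tree $t$ on $V$ by $$\psi(t)=\sum_{r\in V}(t,r),$$ form a monomorphism of operads from $\mathrm{T}$ to $\mathrm{PLie}$.
   Context: $\mathbb{K}$ is a field of characteristic $0$. A (linear) species is a functor from finite sets with bijections to $\mathbb{K}$-vector spaces. An operad is a species $O$ with $O[\emptyset]=\{0\}$, units $e(v)\in O[\{v\}]$, and natural bilinear partial compositions $\circ_*:O[V_1\sqcup\{*\}]\times O[V_2]\to O[V_1\sqcup V_2]$ satisfying the usual parallel and sequential associativity axioms and unit axioms of symmetric operads. A morphism of operads is a natural family of linear maps preserving units and partial compositions; it is a monomorphism if all its components are injective. Operad $\mathrm{T}$: $\mathrm{T}[V]$ ($V$ nonempty) has basis the trees with vertex set $V$ (connected acyclic simple graphs). For a tree $t_1$ on $V_1\sqcup\{*\}$ and a tree $t_2$ on $V_2$, $t_1\circ_*t_2$ is the sum of all trees obtained by taking the disjoint union of $t_1$ and $t_2$, removing $*$ and, for each neighbour of $*$ in $t_1$, adding an edge between this neighbour and any vertex of $t_2$ (sum over all independent choices). The units are the one-vertex trees. Operad $\mathrm{PLie}$ (pre-Lie operad): its underlying species is $\mathrm{T}^{\bullet}$, where $\mathrm{T}^{\bullet}[V]$ has basis the rooted trees $(t,r)$, $t$ a tree on $V$, $r\in V$. For rooted trees $t_1$ on $V_1\sqcup\{*\}$ and $t_2$ on $V_2$, $t_1\circ_* t_2$ is the sum over all rooted trees obtained by taking the disjoint union, removing $*$, adding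 an edge between the parent of $*$ in $t_1$ (if any) and the root of $t_2$, and, for each child of $*$ in $t_1$, adding an edge between this child and any vertex of $t_2$ (sum over all independent choices); the root is the root of $t_1$ if it is not $*$, and the root of $t_2$ otherwise. The units are the one-vertex rooted trees. *)

theory Defs
  imports Complex_Main "HOL-Library.Poly_Mapping" "HOL-Library.FuncSet"
begin

section \<open>Linear species and operads\<close>

text \<open>
  The category of finite sets and bijections is represented by the finite subsets of an arbitrary
  type \<open>'a\<close>. A bijection with source \<open>V\<close> is a function \<open>\<sigma>\<close> that is injective on \<open>V\<close>; its target is
  \<open>\<sigma> ` V\<close>. The spaces \<open>S[V]\<close> of a species are subspaces of one ambient vector space \<open>'v\<close>; they may
  overlap for different \<open>V\<close>.
\<close>

record ('a, 'k, 'v) species_data =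
  smult :: "'k \<Rightarrow> 'v \<Rightarrow> 'v"
  space :: "'a set \<Rightarrow> 'v set"
  relabel :: "'a set \<Rightarrow> ('a \<Rightarrow> 'a) \<Rightarrow> 'v \<Rightarrow> 'v"

definition linear_map_on ::
  "('k \<Rightarrow> 'v::ab_group_add \<Rightarrow> 'v) \<Rightarrow> ('k \<Rightarrow> 'w::ab_group_add \<Rightarrow> 'w) \<Rightarrow> 'v set \<Rightarrow> ('v \<Rightarrow> 'w) \<Rightarrow> bool" where
  "linear_map_on s s' A f \<longleftrightarrow>
     (\<forall>x\<in>A. \<forall>y\<in>A. f (x + y) = f x + f y) \<and> (\<forall>c. \<forall>x\<in>A. f (s c x) = s' c (f x))"

locale linear_species = vector_space "smult S"
  for S :: "('a, 'k::field_char_0, 'v::ab_group_add, 'm) species_data_scheme" +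
  assumes subspace_space: "finite V \<Longrightarrow> subspace (space S V)"
    and relabel_in:
      "\<lbrakk>finite V; inj_on \<sigma> V; x \<in> space S V\<rbrakk> \<Longrightarrow> relabel S V \<sigma> x \<in> space S (\<sigma> ` V)"
    and relabel_linear:
      "\<lbrakk>finite V; inj_on \<sigma> V\<rbrakk> \<Longrightarrow> linear_map_on (smult S) (smult S) (space S V) (relabel S V \<sigma>)"
    and relabel_cong:
      "\<lbrakk>finite V; inj_on \<sigma> V; \<And>v. v \<in> V \<Longrightarrow> \<sigma> v = \<tau> v; x \<in> space S V\<rbrakk>
        \<Longrightarrow> relabel S V \<sigma> x = relabel S V \<tau> x"
    and relabel_id:
      "\<lbrakk>finite V; x \<in> space S V\<rbrakk> \<Longrightarrow> relabel S V (\<lambda>v. v) x = x"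
    and relabel_comp:
      "\<lbrakk>finite V; inj_on \<sigma> V; inj_on \<tau> (\<sigma> ` V); x \<in> space S V\<rbrakk>
        \<Longrightarrow> relabel S V (\<lambda>v. \<tau> (\<sigma> v)) x = relabel S (\<sigma> ` V) \<tau> (relabel S V \<sigma> x)"

text \<open>
  \<open>pcomp P V1 s V2\<close> is the partial composition
  \<open>P[V1 \<squnion> {s}] \<times> P[V2] \<rightarrow> P[V1 \<squnion> V2]\<close> at \<open>s\<close>. The two source sets \<open>V1 \<squnion> {s}\<close> and \<open>V2\<close> need not be
  disjoint, so \<open>s \<in> V2\<close> is allowed; only \<open>s \<notin> V1\<close> and \<open>V1 \<inter> V2 = {}\<close> are required.
\<close>

record ('a, 'k, 'v) operad_data = "('a, 'k, 'v) species_data" +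
  op_unit :: "'a \<Rightarrow> 'v"
  pcomp :: "'a set \<Rightarrow> 'a \<Rightarrow> 'a set \<Rightarrow> 'v \<Rightarrow> 'v \<Rightarrow> 'v"

locale operad = linear_species P
  for P :: "('a, 'k::field_char_0, 'v::ab_group_add, 'm) operad_data_scheme" +
  assumes space_empty: "space P {} = {0}"
    and unit_in: "op_unit P v \<in> space P {v}"
    and unit_natural: "relabel P {v} \<sigma> (op_unit P v) = op_unit P (\<sigma> v)"
    and pcomp_in:
      "\<lbrakk>finite V1; finite V2; s \<notin> V1; V1 \<inter> V2 = {};
        x \<in> space P (insert s V1); y \<in> space P V2\<rbrakk>
        \<Longrightarrow> pcomp P V1 s V2 x y \<in> space P (V1 \<union> V2)"
    and pcomp_linear_left:
      "\<lbrakk>finite V1; finite V2; s \<notin> V1; V1 \<inter> V2 = {}; y \<in> space P V2\<rbrakk>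
        \<Longrightarrow> linear_map_on (smult P) (smult P) (space P (insert s V1)) (\<lambda>x. pcomp P V1 s V2 x y)"
    and pcomp_linear_right:
      "\<lbrakk>finite V1; finite V2; s \<notin> V1; V1 \<inter> V2 = {}; x \<in> space P (insert s V1)\<rbrakk>
        \<Longrightarrow> linear_map_on (smult P) (smult P) (space P V2) (\<lambda>y. pcomp P V1 s V2 x y)"
    and pcomp_natural:
      "\<lbrakk>finite V1; finite V2; s \<notin> V1; V1 \<inter> V2 = {};
        inj_on \<sigma> (insert s V1); inj_on \<tau> V2; \<sigma> ` V1 \<inter> \<tau> ` V2 = {};
        x \<in> space P (insert s V1); y \<in> space P V2\<rbrakk>
        \<Longrightarrow> relabel P (V1 \<union> V2) (\<lambda>v. if v \<in> V1 then \<sigma> v else \<tau> v) (pcomp P V1 s V2 x y)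
          = pcomp P (\<sigma> ` V1) (\<sigma> s) (\<tau> ` V2) (relabel P (insert s V1) \<sigma> x) (relabel P V2 \<tau> y)"
    and pcomp_sequential:
      "\<lbrakk>finite V1; finite V2; finite V3; V1 \<inter> V2 = {}; V1 \<inter> V3 = {}; V2 \<inter> V3 = {};
        s \<notin> V1; s' \<notin> V1; s' \<notin> V2;
        x \<in> space P (insert s V1); y \<in> space P (insert s' V2); z \<in> space P V3\<rbrakk>
        \<Longrightarrow> pcomp P (V1 \<union> V2) s' V3 (pcomp P V1 s (insert s' V2) x y) z
          = pcomp P V1 s (V2 \<union> V3) x (pcomp P V2 s' V3 y z)"
    and pcomp_parallel:
      "\<lbrakk>finite V1; finite V2; finite V3; V1 \<inter> V2 = {}; V1 \<inter> V3 = {}; V2 \<inter> V3 = {};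
        s \<noteq> s'; s \<notin> V1; s' \<notin> V1; s' \<notin> V2; s \<notin> V3;
        x \<in> space P (insert s (insert s' V1)); y \<in> space P V2; z \<in> space P V3\<rbrakk>
        \<Longrightarrow> pcomp P (V1 \<union> V2) s' V3 (pcomp P (insert s' V1) s V2 x y) z
          = pcomp P (V1 \<union> V3) s V2 (pcomp P (insert s V1) s' V3 x z) y"
    and unit_left:
      "\<lbrakk>finite V; x \<in> space P V\<rbrakk> \<Longrightarrow> pcomp P {} s V (op_unit P s) x = x"
    and unit_right:
      "\<lbrakk>finite V; s \<notin> V; v \<notin> V; x \<in> space P (insert s V)\<rbrakk>
        \<Longrightarrow> pcomp P V s {v} x (op_unit P v)
          = relabel P (insert s V) (\<lambda>u. if u = s then v else u) x"

locale operad_morphism = P: operad P + Q: operad Q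
  for P :: "('a, 'k::field_char_0, 'v::ab_group_add, 'm) operad_data_scheme"
    and Q :: "('a, 'k, 'w::ab_group_add, 'n) operad_data_scheme" +
  fixes f :: "'a set \<Rightarrow> 'v \<Rightarrow> 'w"
  assumes map_in: "\<lbrakk>finite V; x \<in> space P V\<rbrakk> \<Longrightarrow> f V x \<in> space Q V"
    and map_linear: "finite V \<Longrightarrow> linear_map_on (smult P) (smult Q) (space P V) (f V)"
    and map_natural:
      "\<lbrakk>finite V; inj_on \<sigma> V; x \<in> space P V\<rbrakk>
        \<Longrightarrow> f (\<sigma> ` V) (relabel P V \<sigma> x) = relabel Q V \<sigma> (f V x)"
    and map_unit: "f {v} (op_unit P v) = op_unit Q v"
    and map_pcomp:
      "\<lbrakk>finite V1; finite V2; s \<notin> V1; V1 \<inter> V2 = {};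
        x \<in> space P (insert s V1); y \<in> space P V2\<rbrakk>
        \<Longrightarrow> f (V1 \<union> V2) (pcomp P V1 s V2 x y)
          = pcomp Q V1 s V2 (f (insert s V1) x) (f V2 y)"

locale operad_monomorphism = operad_morphism +
  assumes map_inj: "finite V \<Longrightarrow> inj_on (f V) (space P V)"


section \<open>Free vector spaces\<close>

text \<open>The vector space with basis \<open>'b\<close> is \<open>'b \<Rightarrow>\<^sub>0 'k\<close>; the basis vectors are \<open>basis b\<close>.\<close>

definition basis :: "'b \<Rightarrow> ('b \<Rightarrow>\<^sub>0 'k::field)" where
  "basis b = Poly_Mapping.single b 1"

definition free_smult :: "'k::field \<Rightarrow> ('b \<Rightarrow>\<^sub>0 'k) \<Rightarrow> ('b \<Rightarrow>\<^sub>0 'k)" where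
  "free_smult c = Poly_Mapping.map ((*) c)"

definition free_on :: "'b set \<Rightarrow> ('b \<Rightarrow>\<^sub>0 'k::field) set" where
  "free_on B = {x. Poly_Mapping.keys x \<subseteq> B}"

definition lin_ext :: "('b \<Rightarrow> ('c \<Rightarrow>\<^sub>0 'k::field)) \<Rightarrow> ('b \<Rightarrow>\<^sub>0 'k) \<Rightarrow> ('c \<Rightarrow>\<^sub>0 'k)" where
  "lin_ext g x = (\<Sum>b\<in>Poly_Mapping.keys x. free_smult (Poly_Mapping.lookup x b) (g b))"

definition bilin_ext ::
  "('b \<Rightarrow> 'c \<Rightarrow> ('d \<Rightarrow>\<^sub>0 'k::field)) \<Rightarrow> ('b \<Rightarrow>\<^sub>0 'k) \<Rightarrow> ('c \<Rightarrow>\<^sub>0 'k) \<Rightarrow> ('d \<Rightarrow>\<^sub>0 'k)" where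
  "bilin_ext g x y = lin_ext (\<lambda>b. lin_ext (g b) y) x"


section \<open>Trees and rooted trees\<close>

text \<open>A graph is a pair of a vertex set and a set of edges, which are two-element sets of vertices.\<close>

type_synonym 'a graph = "'a set \<times> 'a set set"

abbreviation verts :: "'a graph \<Rightarrow> 'a set" where "verts \<equiv> fst"
abbreviation edges :: "'a graph \<Rightarrow> 'a set set" where "edges \<equiv> snd"

definition simple_graph :: "'a graph \<Rightarrow> bool" where
  "simple_graph t \<longleftrightarrow> finite (verts t) \<and>
     (\<forall>e\<in>edges t. \<exists>u\<in>verts t. \<exists>v\<in>verts t. u \<noteq> v \<and> e = {u, v})"

definition is_path :: "'a graph \<Rightarrow> 'a list \<Rightarrow> bool" where
  "is_path t p \<longleftrightarrow> p \<noteq> [] \<and> set p \<subseteq> verts t \<and> distinct p \<and> successively (\<lambda>u v. {u, v} \<in> edges t) p"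

definition connected_graph :: "'a graph \<Rightarrow> bool" where
  "connected_graph t \<longleftrightarrow> verts t \<noteq> {} \<and>
     (\<forall>u\<in>verts t. \<forall>v\<in>verts t. \<exists>p. is_path t p \<and> hd p = u \<and> last p = v)"

definition acyclic_graph :: "'a graph \<Rightarrow> bool" where
  "acyclic_graph t \<longleftrightarrow> \<not> (\<exists>p. is_path t p \<and> length p \<ge> 3 \<and> {last p, hd p} \<in> edges t)"

definition trees :: "'a set \<Rightarrow> 'a graph set" where
  "trees V = {t. verts t = V \<and> simple_graph t \<and> connected_graph t \<and> acyclic_graph t}"

type_synonym 'a rgraph = "'a graph \<times> 'a"

definition rooted_trees :: "'a set \<Rightarrow> 'a rgraph set" where
  "rooted_trees V = {(t, r). t \<in> trees V \<and> r \<in> V}"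

definition neighbours :: "'a graph \<Rightarrow> 'a \<Rightarrow> 'a set" where
  "neighbours t v = {u. {u, v} \<in> edges t}"

text \<open>The parent of a vertex is the vertex before it on the path from the root.\<close>

definition parents :: "'a rgraph \<Rightarrow> 'a \<Rightarrow> 'a set" where
  "parents = (\<lambda>(t, r) v. {u. \<exists>p. is_path t (p @ [u, v]) \<and> hd (p @ [u, v]) = r})"

definition children :: "'a rgraph \<Rightarrow> 'a \<Rightarrow> 'a set" where
  "children tr v = {u. v \<in> parents tr u}"

definition map_graph :: "('a \<Rightarrow> 'b) \<Rightarrow> 'a graph \<Rightarrow> 'b graph" where
  "map_graph \<sigma> t = (\<sigma> ` verts t, (\<lambda>e. \<sigma> ` e) ` edges t)"

definition map_rgraph :: "('a \<Rightarrow> 'b) \<Rightarrow> 'a rgraph \<Rightarrow> 'b rgraph" where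
  "map_rgraph \<sigma> = (\<lambda>(t, r). (map_graph \<sigma> t, \<sigma> r))"

text \<open>
  \<open>replace_vertex t1 s t2 F\<close> is the disjoint union of \<open>t1\<close> without the vertex \<open>s\<close> (and without the
  edges at \<open>s\<close>) and \<open>t2\<close>, with the edges \<open>F\<close> added.
\<close>

definition replace_vertex :: "'a graph \<Rightarrow> 'a \<Rightarrow> 'a graph \<Rightarrow> 'a set set \<Rightarrow> 'a graph" where
  "replace_vertex t1 s t2 F =
     ((verts t1 - {s}) \<union> verts t2, {e \<in> edges t1. s \<notin> e} \<union> edges t2 \<union> F)"


section \<open>The operads T and PLie\<close>

definition tree_comp :: "'a \<Rightarrow> 'a graph \<Rightarrow> 'a graph \<Rightarrow> ('a graph \<Rightarrow>\<^sub>0 'k::field)" where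
  "tree_comp s t1 t2 =
     (\<Sum>h \<in> neighbours t1 s \<rightarrow>\<^sub>E verts t2.
        basis (replace_vertex t1 s t2 {{n, h n} |n. n \<in> neighbours t1 s}))"

definition T_operad :: "('a, 'k::field_char_0, 'a graph \<Rightarrow>\<^sub>0 'k) operad_data" where
  "T_operad = \<lparr>
     smult = free_smult,
     space = (\<lambda>V. free_on (trees V)),
     relabel = (\<lambda>V \<sigma>. lin_ext (\<lambda>t. basis (map_graph \<sigma> t))),
     op_unit = (\<lambda>v. basis ({v}, {})),
     pcomp = (\<lambda>V1 s V2. bilin_ext (tree_comp s))\<rparr>"

definition rooted_tree_comp :: "'a \<Rightarrow> 'a rgraph \<Rightarrow> 'a rgraph \<Rightarrow> ('a rgraph \<Rightarrow>\<^sub>0 'k::field)" where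
  "rooted_tree_comp s = (\<lambda>(t1, r1) (t2, r2).
     \<Sum>h \<in> children (t1, r1) s \<rightarrow>\<^sub>E verts t2.
       basis (replace_vertex t1 s t2
                ({{p, r2} |p. p \<in> parents (t1, r1) s} \<union> {{c, h c} |c. c \<in> children (t1, r1) s}),
              if r1 = s then r2 else r1))"

definition PLie_operad :: "('a, 'k::field_char_0, 'a rgraph \<Rightarrow>\<^sub>0 'k) operad_data" where
  "PLie_operad = \<lparr>
     smult = free_smult,
     space = (\<lambda>V. free_on (rooted_trees V)),
     relabel = (\<lambda>V \<sigma>. lin_ext (\<lambda>t. basis (map_rgraph \<sigma> t))),
     op_unit = (\<lambda>v. basis (({v}, {}), v)),
     pcomp = (\<lambda>V1 s V2. bilin_ext (rooted_tree_comp s))\<rparr>"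

definition \<psi> :: "'a set \<Rightarrow> ('a graph \<Rightarrow>\<^sub>0 'k::field) \<Rightarrow> ('a rgraph \<Rightarrow>\<^sub>0 'k)" where
  "\<psi> V = lin_ext (\<lambda>t. \<Sum>r\<in>V. basis (t, r))"

end

(*
  All coefficients of t1 o_s t2 are 0 or 1: a tree t on V1 u V2 occurs if and only if its restriction
  to V2 is t2 and the contraction of V2 to s turns it into t1. The edge {n, s} of t1 then lifts to a
  unique edge of t, because contracting a subtree of a tree identifies no two edges. For rooted trees
  the same holds, where the contraction maps the root along and the restriction is rooted at the first
  vertex of V2 on the path from the root. Associativity, the unit laws and naturality thus become
  compatibilities between restrictions and contractions, the same for both operads.

  In psi(t1) o_s psi(t2) the rooted tree (t, r) arises from exactly one choice of roots of t1 and t2,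
  namely the image of r under contraction and the first vertex of V2 on the path from r. Hence every
  tree t of t1 o_s t2 occurs once with every root. Keeping only one root inverts psi.
*)
theory Submission
  imports Defs
begin

text \<open>Acyclicity is awkward to carry through contractions. Trees are therefore handled as
  connected graphs with one edge fewer than vertices: edge counts add up over the edges inside and
  outside \<open>W\<close>, and this is what shows that no two edges are identified. In the
  converse, where a graph is to be a tree because a restriction and a contraction of it are,
  injectivity on edges has to be assumed, since an edge set cannot record parallel edges. The
  restriction of a tree is in general only a forest, and then the root it should inherit makes no
  sense. This is why several laws about restrictions carry the condition that the restriction is
  again a basis element, and why a gate is introduced as a relation, transported step by step, and
  becomes a function only where it is unique. The point \<open>s\<close> to which \<open>W\<close>
  is contracted may itself belong to \<open>W\<close>, because the partial composition at
  \<open>s\<close> allows \<open>s\<close> in the second vertex set. Hence the recurring condition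
  \<open>s \<notin> V - W\<close>.\<close>

section \<open>Free vector spaces\<close>

lemma lookup_free_smult [simp]:
  "Poly_Mapping.lookup (free_smult c x) b = c * Poly_Mapping.lookup x b"
  unfolding free_smult_def by (simp add: map.rep_eq when_def)

lemma vector_space_free: "vector_space (free_smult :: 'k::field \<Rightarrow> ('b \<Rightarrow>\<^sub>0 'k) \<Rightarrow> _)"
  by unfold_locales (auto intro!: poly_mapping_eqI simp: lookup_add algebra_simps)

interpretation free: vector_space "free_smult :: 'k::field \<Rightarrow> ('b \<Rightarrow>\<^sub>0 'k) \<Rightarrow> _"
  by (rule vector_space_free)

lemma free_smult_sum: "free_smult c (\<Sum>a\<in>A. f a) = (\<Sum>a\<in>A. free_smult c (f a))"
  by (rule free.scale_sum_right)

lemma basis_in_free_on [simp]: "basis b \<in> (free_on B :: ('b \<Rightarrow>\<^sub>0 'k::field) set) \<longleftrightarrow> b \<in> B"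
  by (simp add: basis_def free_on_def)

lemma keys_free_smult: "Poly_Mapping.keys (free_smult c x) \<subseteq> Poly_Mapping.keys x"
  by (auto simp: in_keys_iff)

lemma subspace_free_on: "free.subspace (free_on B :: ('b \<Rightarrow>\<^sub>0 'k::field) set)"
proof -
  have "Poly_Mapping.keys (x + y) \<subseteq> B"
    if "Poly_Mapping.keys x \<subseteq> B" "Poly_Mapping.keys y \<subseteq> B" for x y :: "'b \<Rightarrow>\<^sub>0 'k::field"
    using that Poly_Mapping.keys_add[of x y] by blast
  moreover have "Poly_Mapping.keys (free_smult c x) \<subseteq> B"
    if "Poly_Mapping.keys x \<subseteq> B" for c and x :: "'b \<Rightarrow>\<^sub>0 'k::field"
    using that keys_free_smult[of c x] by blast
  ultimately show ?thesis by (simp add: free.subspace_def free_on_def)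
qed

lemma free_on_empty [simp]: "free_on {} = {0}"
  by (auto simp: free_on_def)

lemma free_on_expansion:
  "x = (\<Sum>b\<in>Poly_Mapping.keys x. free_smult (Poly_Mapping.lookup x b) (basis b))"
  by (rule poly_mapping_eqI)
    (auto simp: lookup_sum basis_def lookup_single when_def if_distrib in_keys_iff cong: if_cong)

text \<open>Multilinear identities are checked on basis vectors with this rule, one argument at a
  time; the cases \<open>add\<close> and \<open>smult\<close> follow from linearity of both sides in
  that argument.\<close>

lemma free_on_induct [consumes 1, case_names zero basis add smult]:
  fixes x :: "'b \<Rightarrow>\<^sub>0 'k::field"
  assumes "x \<in> free_on B" and "P 0" and "\<And>b. b \<in> B \<Longrightarrow> P (basis b)"
    and add: "\<And>x y. P x \<Longrightarrow> P y \<Longrightarrow> P (x + y)" and smult: "\<And>c x. P x \<Longrightarrow> P (free_smult c x)"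
  shows "P x"
proof -
  have "P (\<Sum>b\<in>A. free_smult (Poly_Mapping.lookup x b) (basis b))" if "A \<subseteq> B" "finite A" for A
    using that(2,1) by (induction A rule: finite_induct) (auto intro!: assms)
  from this[of "Poly_Mapping.keys x"] assms(1) show ?thesis
    by (simp add: free_on_def flip: free_on_expansion)
qed

text \<open>The index set in \<open>lin_ext\<close> is the support and so depends on the vector.
  Additional indices contribute zero, so several vectors can be summed over one common set, and
  additivity becomes a termwise identity.\<close>

lemma lin_ext_superset:
  assumes "finite A" "Poly_Mapping.keys x \<subseteq> A"
  shows "lin_ext g x = (\<Sum>b\<in>A. free_smult (Poly_Mapping.lookup x b) (g b))"
  unfolding lin_ext_def using assms
  by (intro sum.mono_neutral_left) (auto simp: in_keys_iff)

lemma lin_ext_zero [simp]: "lin_ext g 0 = 0"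
  by (simp add: lin_ext_def)

lemma lin_ext_basis [simp]: "lin_ext g (basis b) = g b"
  by (simp add: lin_ext_def basis_def)

lemma lin_ext_add [simp]: "lin_ext g (x + y) = lin_ext g x + lin_ext g y"
proof -
  let ?A = "Poly_Mapping.keys x \<union> Poly_Mapping.keys y"
  have "Poly_Mapping.keys (x + y) \<subseteq> ?A" by (rule Poly_Mapping.keys_add)
  then show ?thesis
    by (simp add: lin_ext_superset[of ?A] lookup_add free.scale_left_distrib sum.distrib)
qed

lemma lin_ext_smult [simp]: "lin_ext g (free_smult c x) = free_smult c (lin_ext g x)"
  using keys_free_smult[of c x]
  by (simp add: lin_ext_superset[of "Poly_Mapping.keys x"] free_smult_sum)

lemma lin_ext_sum: "lin_ext g (\<Sum>a\<in>A. f a) = (\<Sum>a\<in>A. lin_ext g (f a))"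
  by (induction A rule: infinite_finite_induct) auto

lemma lin_ext_fun_add: "lin_ext (\<lambda>b. g b + h b) x = lin_ext g x + lin_ext h x"
  by (simp add: lin_ext_def free.scale_right_distrib sum.distrib)

lemma lin_ext_fun_smult: "lin_ext (\<lambda>b. free_smult c (g b)) x = free_smult c (lin_ext g x)"
  by (simp add: lin_ext_def free_smult_sum mult.commute)

lemma lin_ext_fun_zero [simp]: "lin_ext (\<lambda>b. 0) x = 0"
  by (simp add: lin_ext_def)

lemma lin_ext_fun_sum: "lin_ext (\<lambda>b. \<Sum>a\<in>A. g a b) x = (\<Sum>a\<in>A. lin_ext (g a) x)"
  by (induction A rule: infinite_finite_induct) (auto simp: lin_ext_fun_add)

lemma lin_ext_in:
  assumes "x \<in> free_on B" and "\<And>b. b \<in> B \<Longrightarrow> g b \<in> free_on C"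
  shows "lin_ext g x \<in> free_on C"
  using assms(1)
  by (induction rule: free_on_induct)
    (auto simp: assms(2) free.subspace_0 free.subspace_add free.subspace_scale subspace_free_on)

section \<open>Bilinear extension\<close>

lemma bilin_ext_basis [simp]: "bilin_ext g (basis a) (basis b) = g a b"
  by (simp add: bilin_ext_def)

lemma bilin_ext_zero [simp]: "bilin_ext g 0 y = 0" "bilin_ext g x 0 = 0"
  by (simp_all add: bilin_ext_def)

lemma bilin_ext_add [simp]:
  "bilin_ext g (x + x') y = bilin_ext g x y + bilin_ext g x' y"
  "bilin_ext g x (y + y') = bilin_ext g x y + bilin_ext g x y'"
  by (simp_all add: bilin_ext_def lin_ext_fun_add)

lemma bilin_ext_smult [simp]:
  "bilin_ext g (free_smult c x) y = free_smult c (bilin_ext g x y)"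
  "bilin_ext g x (free_smult c y) = free_smult c (bilin_ext g x y)"
  by (simp_all add: bilin_ext_def lin_ext_fun_smult)

lemma bilin_ext_sum:
  "bilin_ext g (\<Sum>a\<in>A. f a) y = (\<Sum>a\<in>A. bilin_ext g (f a) y)"
  "bilin_ext g x (\<Sum>a\<in>A. f a) = (\<Sum>a\<in>A. bilin_ext g x (f a))"
  by (simp_all add: bilin_ext_def lin_ext_sum lin_ext_fun_sum)

lemma bilin_ext_in:
  assumes "x \<in> free_on A" "y \<in> free_on B" and "\<And>a b. a \<in> A \<Longrightarrow> b \<in> B \<Longrightarrow> g a b \<in> free_on C"
  shows "bilin_ext g x y \<in> free_on C"
  unfolding bilin_ext_def using assms by (blast intro: lin_ext_in)

lemma free_on_sum_basis: "A \<subseteq> B \<Longrightarrow> (\<Sum>a\<in>A. basis a) \<in> free_on B"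
  by (intro free.subspace_sum subspace_free_on) auto

section \<open>Trees as connected graphs with one edge fewer than vertices\<close>

text \<open>As a relation, adjacency has a reflexive transitive closure: reachability by walks takes
  the place of the simple paths in the definition of connectedness.\<close>

definition adj :: "'a set set \<Rightarrow> ('a \<times> 'a) set" where
  "adj E = {(u, v). {u, v} \<in> E}"

definition joined :: "'a set \<Rightarrow> 'a set set \<Rightarrow> bool" where
  "joined V E \<longleftrightarrow> V \<noteq> {} \<and> (\<forall>u\<in>V. \<forall>v\<in>V. (u, v) \<in> (adj E)\<^sup>*)"

lemma sym_adj: "sym (adj E)"
  by (auto simp: adj_def sym_def insert_commute)

lemma adj_rtrancl_sym: "(u, v) \<in> (adj E)\<^sup>* \<Longrightarrow> (v, u) \<in> (adj E)\<^sup>*"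
  by (meson sym_adj sym_rtrancl symD)

lemma simple_graphD:
  assumes "simple_graph t" "{u, v} \<in> edges t"
  shows "u \<in> verts t" "v \<in> verts t" "u \<noteq> v"
  using assms unfolding simple_graph_def by (metis doubleton_eq_iff)+

lemma simple_graph_cases:
  assumes "simple_graph t" "e \<in> edges t"
  obtains u v where "e = {u, v}" "u \<in> verts t" "v \<in> verts t" "u \<noteq> v"
  using assms unfolding simple_graph_def by blast

lemma simple_graph_edges_Pow: "simple_graph t \<Longrightarrow> edges t \<subseteq> Pow (verts t)"
  by (auto elim: simple_graph_cases)

lemma finite_edges: "simple_graph t \<Longrightarrow> finite (edges t)"
  by (metis simple_graph_edges_Pow finite_Pow_iff finite_subset simple_graph_def)

text \<open>The path grows along the walk and is cut back whenever the next vertex already lies on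
  it. The last clause is what later places the vertices of the path in a given set. \<open>R\<close>
  is arbitrary because walks that avoid a set are shortened in the same way.\<close>

lemma path_if_rtrancl:
  assumes "(u, v) \<in> R\<^sup>*"
  obtains p where "p \<noteq> []" "distinct p" "successively (\<lambda>a b. (a, b) \<in> R) p" "hd p = u" "last p = v"
    "\<forall>x\<in>set p. (u, x) \<in> R\<^sup>*"
proof -
  have "\<exists>p. p \<noteq> [] \<and> distinct p \<and> successively (\<lambda>a b. (a, b) \<in> R) p \<and> hd p = u \<and> last p = v \<and>
      (\<forall>x\<in>set p. (u, x) \<in> R\<^sup>*)"
    using assms
  proof (induction rule: rtrancl_induct)
    case base
    show ?case by (intro exI[of _ "[u]"]) auto
  next
    case (step y z)
    then obtain p where p: "p \<noteq> []" "distinct p" "successively (\<lambda>a b. (a, b) \<in> R) p" "hd p = u"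
      "last p = y" "\<forall>x\<in>set p. (u, x) \<in> R\<^sup>*"
      by blast
    show ?case
    proof (cases "z \<in> set p")
      case True
      then obtain xs ys where xs: "p = xs @ z # ys" by (meson split_list)
      with p show ?thesis
        by (intro exI[of _ "xs @ [z]"]) (auto simp: successively_append_iff hd_append split: if_splits)
    next
      case False
      with p step show ?thesis
        by (intro exI[of _ "p @ [z]"]) (auto simp: successively_append_iff intro: rtrancl_into_rtrancl)
    qed
  qed
  then show thesis using that by blast
qed

lemma rtrancl_if_path:
  assumes "p \<noteq> []" "successively (\<lambda>a b. (a, b) \<in> R) p"
  shows "(hd p, last p) \<in> R\<^sup>*"
  using assms
proof (induction p rule: rev_nonempty_induct)
  case (snoc x xs)
  then show ?case by (auto simp: successively_append_iff intro: rtrancl_into_rtrancl)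
qed auto

lemma is_path_adj:
  "is_path t p \<longleftrightarrow> p \<noteq> [] \<and> set p \<subseteq> verts t \<and> distinct p \<and> successively (\<lambda>u v. (u, v) \<in> adj (edges t)) p"
  by (simp add: is_path_def adj_def)

lemma simple_graph_rtrancl_verts:
  assumes "simple_graph t" "(u, v) \<in> (adj (edges t))\<^sup>*" "u \<in> verts t"
  shows "v \<in> verts t"
  using assms(2,3) by induction (auto simp: adj_def dest: simple_graphD[OF assms(1)])

lemma path_in_graph:
  assumes "simple_graph t" "(u, v) \<in> (adj (edges t))\<^sup>*" "u \<in> verts t"
  obtains p where "is_path t p" "hd p = u" "last p = v"
proof -
  obtain p where p: "p \<noteq> []" "distinct p" "successively (\<lambda>a b. (a, b) \<in> adj (edges t)) p"
    "hd p = u" "last p = v" "\<forall>x\<in>set p. (u, x) \<in> (adj (edges t))\<^sup>*"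
    using path_if_rtrancl[OF assms(2)] by blast
  with assms have "is_path t p"
    by (auto simp: is_path_adj dest: simple_graph_rtrancl_verts)
  with p that show thesis by blast
qed

lemma connected_graph_iff_joined:
  assumes "simple_graph t"
  shows "connected_graph t \<longleftrightarrow> joined (verts t) (edges t)"
proof
  assume "connected_graph t"
  then show "joined (verts t) (edges t)"
    unfolding connected_graph_def joined_def is_path_adj
    by (metis rtrancl_if_path)
next
  assume "joined (verts t) (edges t)"
  then show "connected_graph t"
    unfolding connected_graph_def joined_def by (meson path_in_graph[OF assms])
qed

text \<open>Every vertex other than a fixed root picks an edge towards a vertex closer to the root; these
  edges are distinct and form a spanning tree.\<close>

lemma spanning_tree_edges:
  assumes "simple_graph t" "joined (verts t) (edges t)"
  obtains F where "F \<subseteq> edges t" "joined (verts t) F" "card F + 1 = card (verts t)"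
proof -
  define V E where "V = verts t" and "E = edges t"
  have fin: "finite V" and E: "joined V E" using assms by (auto simp: V_def E_def simple_graph_def)
  obtain r where r: "r \<in> V" using E by (auto simp: joined_def)
  define d where "d v = (LEAST n. (r, v) \<in> adj E ^^ n)" for v
  have reach: "(r, v) \<in> adj E ^^ d v" if "v \<in> V" for v
  proof -
    have "(r, v) \<in> (adj E)\<^sup>*" using E r that by (auto simp: joined_def)
    then obtain n where "(r, v) \<in> adj E ^^ n" using rtrancl_imp_relpow by blast
    then show ?thesis unfolding d_def by (rule LeastI)
  qed
  have "\<exists>u\<in>V. {u, v} \<in> E \<and> d u < d v" if v: "v \<in> V" "v \<noteq> r" for v
  proof (cases "d v")
    case 0
    with reach[of v] v show ?thesis by simp
  next
    case (Suc n)
    with reach[of v] v obtain u where u: "(r, u) \<in> adj E ^^ n" "{u, v} \<in> E"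
      by (auto simp: adj_def)
    have "d u \<le> n" unfolding d_def using u(1) by (rule Least_le)
    moreover have "u \<in> V" using u(2) simple_graphD(1)[OF assms(1)] by (simp add: V_def E_def)
    ultimately show ?thesis using u Suc by auto
  qed
  then obtain par where par: "\<And>v. v \<in> V - {r} \<Longrightarrow> par v \<in> V \<and> {par v, v} \<in> E \<and> d (par v) < d v"
    by (metis DiffD1 DiffD2 singletonI)
  define F where "F = (\<lambda>v. {par v, v}) ` (V - {r})"
  \<comment> \<open>Distinct vertices with the same edge would be parents of each other, and
    \<open>d\<close> would decrease in both directions.\<close>
  have "inj_on (\<lambda>v. {par v, v}) (V - {r})"
  proof (rule inj_onI)
    fix v w assume vw: "v \<in> V - {r}" "w \<in> V - {r}" "{par v, v} = {par w, w}"
    show "v = w"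
    proof (rule ccontr)
      assume "v \<noteq> w"
      with vw have "par v = w" "par w = v" by (metis doubleton_eq_iff)+
      with par[OF vw(1)] par[OF vw(2)] show False by simp
    qed
  qed
  then have card: "card F + 1 = card V"
    using r fin card_Suc_Diff1[of V r] by (simp add: F_def card_image)
  have rF: "(r, v) \<in> (adj F)\<^sup>*" if "v \<in> V" for v
    using that
  proof (induction "d v" arbitrary: v rule: less_induct)
    case less
    show ?case
    proof (cases "v = r")
      case False
      with less par[of v] have "(r, par v) \<in> (adj F)\<^sup>*" by simp
      moreover have "(par v, v) \<in> adj F" using False less by (auto simp: adj_def F_def)
      ultimately show ?thesis by simp
    qed simp
  qed
  have "joined V F"
    unfolding joined_def using r rF adj_rtrancl_sym by (meson empty_iff rtrancl_trans)
  moreover have "F \<subseteq> E" using par by (auto simp: F_def)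
  ultimately show thesis using that card by (simp add: V_def E_def)
qed

lemma joined_card_ge:
  assumes "simple_graph t" "joined (verts t) (edges t)"
  shows "card (verts t) \<le> card (edges t) + 1"
proof -
  obtain F where "F \<subseteq> edges t" "card F + 1 = card (verts t)"
    using spanning_tree_edges assms(1,2) by metis
  with finite_edges[OF assms(1)] show ?thesis by (metis add_right_mono card_mono)
qed

text \<open>The rest of a cycle bypasses any one of its edges, so deleting that edge keeps the graph
  connected but leaves fewer edges than connectedness requires.\<close>

lemma acyclic_if_card:
  assumes "simple_graph t" "joined (verts t) (edges t)" "card (edges t) + 1 = card (verts t)"
  shows "acyclic_graph t"
  unfolding acyclic_graph_def
proof
  assume "\<exists>p. is_path t p \<and> length p \<ge> 3 \<and> {last p, hd p} \<in> edges t"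
  then obtain p where p: "is_path t p" "length p \<ge> 3" "{last p, hd p} \<in> edges t" by blast
  define E where "E = edges t - {{last p, hd p}}"
  have "\<exists>a b c q. p = a # b # q @ [c]"
  proof -
    obtain a b c' q' where "p = a # b # c' # q'"
      using p(2) by (metis Suc_le_length_iff numeral_3_eq_3)
    then show ?thesis by (metis rev_exhaust list.distinct(1))
  qed
  then obtain a b c q where pq: "p = a # b # q @ [c]" by blast
  \<comment> \<open>With at least three distinct vertices, the closing edge \<open>{c, a}\<close> is
    none of the edges between consecutive vertices of \<open>p\<close>, so the path survives the
    deletion.\<close>
  have "successively (\<lambda>u v. (u, v) \<in> adj E) p"
    using p(1) unfolding pq is_path_def
    by (auto simp: successively_append_iff successively_Cons adj_def E_def pq doubleton_eq_iff
        hd_append split: if_splits elim!: successively_mono)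
  then have ac: "(a, c) \<in> (adj E)\<^sup>*"
    using rtrancl_if_path[of p "adj E"] by (simp add: pq)
  have "adj (edges t) \<subseteq> (adj E)\<^sup>*"
  proof clarify
    fix u v assume uv: "(u, v) \<in> adj (edges t)"
    show "(u, v) \<in> (adj E)\<^sup>*"
    proof (cases "{u, v} = {c, a}")
      case True
      then show ?thesis using ac adj_rtrancl_sym[OF ac] by (auto simp: doubleton_eq_iff)
    next
      case False
      with uv show ?thesis by (auto simp: adj_def E_def pq)
    qed
  qed
  then have "(adj (edges t))\<^sup>* \<subseteq> (adj E)\<^sup>*" by (rule rtrancl_subset_rtrancl)
  with assms(2) have "joined (verts t) E" by (auto simp: joined_def)
  moreover have "simple_graph (verts t, E)"
    using assms(1) by (auto simp: simple_graph_def E_def)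
  ultimately have "card (verts t) \<le> card E + 1" using joined_card_ge[of "(verts t, E)"] by simp
  moreover have "card E + 1 = card (edges t)"
    unfolding E_def using p(3) card_Suc_Diff1[OF finite_edges[OF assms(1)]] by simp
  ultimately show False using assms(3) by simp
qed

text \<open>Every edge lies in a spanning tree \<open>F\<close>: the path in \<open>F\<close>
  between its ends would close to a cycle with the edge if it had three or more vertices, so it
  consists of the edge itself.\<close>

lemma card_if_acyclic:
  assumes "simple_graph t" "joined (verts t) (edges t)" "acyclic_graph t"
  shows "card (edges t) + 1 = card (verts t)"
proof -
  obtain F where F: "F \<subseteq> edges t" "joined (verts t) F" "card F + 1 = card (verts t)"
    using spanning_tree_edges assms(1,2) by metis
  have "edges t \<subseteq> F"
  proof
    fix e assume e: "e \<in> edges t"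
    obtain u v where uv: "e = {u, v}" "u \<in> verts t" "v \<in> verts t" "u \<noteq> v"
      using simple_graph_cases[OF assms(1) e] .
    have sF: "simple_graph (verts t, F)" using assms(1) F(1) by (auto simp: simple_graph_def)
    have "(u, v) \<in> (adj F)\<^sup>*" using F(2) uv by (simp add: joined_def)
    then obtain p where p: "is_path (verts t, F) p" "hd p = u" "last p = v"
      using path_in_graph[OF sF] uv by auto
    have "is_path t p" using p(1) F(1) by (auto simp: is_path_def intro: successively_mono)
    then have "\<not> length p \<ge> 3"
      using assms(3) e p uv by (auto simp: acyclic_graph_def insert_commute)
    moreover have "p \<noteq> []" using p by (auto simp: is_path_def)
    moreover have "length p \<noteq> 1" using p uv by (auto simp: length_Suc_conv)
    ultimately have "length p = 2" by (cases "length p") auto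
    then have "p = [u, v]" using p by (auto simp: numeral_2_eq_2 length_Suc_conv)
    then show "e \<in> F" using p(1) uv by (simp add: is_path_def)
  qed
  with F(1) have "edges t = F" by (rule subset_antisym[rotated])
  with F(3) show ?thesis by simp
qed

text \<open>Acyclicity is traded for an edge count, which can be split along a subset of the
  vertices. Later proofs that a graph is a tree rest on this form.\<close>

lemma trees_iff:
  "t \<in> trees V \<longleftrightarrow> verts t = V \<and> simple_graph t \<and> joined V (edges t) \<and> card (edges t) + 1 = card V"
  unfolding trees_def using connected_graph_iff_joined acyclic_if_card card_if_acyclic by blast

lemma treesD:
  assumes "t \<in> trees V"
  shows "verts t = V" "simple_graph t" "joined V (edges t)" "finite V" "V \<noteq> {}"
  using assms by (auto simp: trees_iff simple_graph_def joined_def)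

lemma finite_trees:
  assumes "finite V"
  shows "finite (trees V)"
proof (rule finite_subset)
  show "trees V \<subseteq> {V} \<times> Pow (Pow V)"
    by (force simp: trees_iff dest!: simple_graph_edges_Pow)
qed (use assms in simp)

section \<open>Restriction and contraction\<close>

definition collapse :: "'a set \<Rightarrow> 'a \<Rightarrow> 'a \<Rightarrow> 'a" where
  "collapse W s v = (if v \<in> W then s else v)"

definition restr :: "'a set \<Rightarrow> 'a graph \<Rightarrow> 'a graph" where
  "restr W t = (W, {e \<in> edges t. e \<subseteq> W})"

text \<open>Edges inside \<open>W\<close> would become loops and are dropped. As edges form a set,
  two edges with the same image merge silently; that this does not happen is a separate fact about
  trees.\<close>

definition contr :: "'a set \<Rightarrow> 'a \<Rightarrow> 'a graph \<Rightarrow> 'a graph" where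
  "contr W s t = (insert s (verts t - W), (`) (collapse W s) ` {e \<in> edges t. \<not> e \<subseteq> W})"

lemma verts_restr [simp]: "verts (restr W t) = W"
  by (simp add: restr_def)

lemma edges_restr [simp]: "edges (restr W t) = {e \<in> edges t. e \<subseteq> W}"
  by (simp add: restr_def)

lemma verts_contr [simp]: "verts (contr W s t) = insert s (verts t - W)"
  by (simp add: contr_def)

lemma edges_contr: "edges (contr W s t) = (`) (collapse W s) ` {e \<in> edges t. \<not> e \<subseteq> W}"
  by (simp add: contr_def)

lemma collapse_simps [simp]: "v \<in> W \<Longrightarrow> collapse W s v = s" "v \<notin> W \<Longrightarrow> collapse W s v = v"
  by (simp_all add: collapse_def)

lemma simple_graph_edge_subset: "simple_graph t \<Longrightarrow> e \<in> edges t \<Longrightarrow> e \<subseteq> verts t"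
  using simple_graph_edges_Pow by blast

lemma simple_graph_restr:
  assumes "simple_graph t" "W \<subseteq> verts t"
  shows "simple_graph (restr W t)"
  using assms finite_subset unfolding simple_graph_def by fastforce

lemma simple_graph_contr:
  assumes "simple_graph t" "s \<notin> verts t - W"
  shows "simple_graph (contr W s t)"
  unfolding simple_graph_def
proof (intro conjI ballI)
  show "finite (verts (contr W s t))" using assms by (simp add: simple_graph_def)
  fix e assume "e \<in> edges (contr W s t)"
  then obtain d where d: "d \<in> edges t" "\<not> d \<subseteq> W" "e = collapse W s ` d"
    by (auto simp: edges_contr)
  obtain u v where uv: "d = {u, v}" "u \<in> verts t" "v \<in> verts t" "u \<noteq> v"
    using simple_graph_cases[OF assms(1) d(1)] .
  have "collapse W s u \<noteq> collapse W s v"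
    using d(2) uv assms(2) by (auto simp: collapse_def)
  moreover have "e = {collapse W s u, collapse W s v}" using d uv by simp
  moreover have "collapse W s x \<in> verts (contr W s t)" if "x \<in> verts t" for x
    using that by (simp add: collapse_def)
  ultimately show "\<exists>u\<in>verts (contr W s t). \<exists>v\<in>verts (contr W s t). u \<noteq> v \<and> e = {u, v}"
    using uv by blast
qed

lemma edge_contr:
  assumes "{u, v} \<in> edges t" "\<not> {u, v} \<subseteq> W"
  shows "{collapse W s u, collapse W s v} \<in> edges (contr W s t)"
proof -
  have "{collapse W s u, collapse W s v} = collapse W s ` {u, v}" by simp
  with assms show ?thesis unfolding edges_contr by blast
qed

text \<open>Walks are pushed forward along \<open>collapse\<close>, where a step inside
  \<open>W\<close> becomes a pause at \<open>s\<close>.\<close>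

lemma joined_contr:
  assumes "joined V (edges t)" "W \<subseteq> V" "W \<noteq> {}"
  shows "joined (insert s (V - W)) (edges (contr W s t))"
proof -
  have walk: "(collapse W s u, collapse W s v) \<in> (adj (edges (contr W s t)))\<^sup>*"
    if "(u, v) \<in> (adj (edges t))\<^sup>*" for u v
    using that
  proof induction
    case (step y z)
    show ?case
    proof (cases "{y, z} \<subseteq> W")
      case True
      then show ?thesis using step by simp
    next
      case False
      with step have "(collapse W s y, collapse W s z) \<in> adj (edges (contr W s t))"
        by (auto simp: adj_def intro: edge_contr)
      with step show ?thesis by simp
    qed
  qed simp
  have "\<exists>u\<in>V. a = collapse W s u" if "a \<in> insert s (V - W)" for a
    using that assms(2,3) by (metis Diff_iff all_not_in_conv collapse_simps insertE subsetD)
  with walk assms(1) show ?thesis unfolding joined_def by (metis insert_not_empty)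
qed

text \<open>A walk in the contraction lifts edge by edge. Consecutive lifted edges need not meet,
  but two vertices with the same image coincide or both lie in \<open>W\<close>, which is connected.
  For this reason the induction covers all \<open>v\<close> in the fibre over the end of the
  walk.\<close>

lemma joined_if_joined_contr:
  assumes t: "simple_graph t" and "W \<subseteq> verts t" and s: "s \<notin> verts t - W"
    and W: "joined W (edges (restr W t))"
    and c: "joined (verts (contr W s t)) (edges (contr W s t))"
  shows "joined (verts t) (edges t)"
proof -
  have same: "(u, v) \<in> (adj (edges t))\<^sup>*"
    if "u \<in> verts t" "v \<in> verts t" "collapse W s u = collapse W s v" for u v
  proof (cases "u = v")
    case False
    with that s have "u \<in> W" "v \<in> W" by (auto simp: collapse_def split: if_splits)
    then have "(u, v) \<in> (adj (edges (restr W t)))\<^sup>*" using W by (simp add: joined_def)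
    then show ?thesis by (rule rtrancl_mono[THEN subsetD, rotated]) (auto simp: adj_def)
  qed simp
  have "(u, v) \<in> (adj (edges t))\<^sup>*"
    if "(collapse W s u, b) \<in> (adj (edges (contr W s t)))\<^sup>*"
      "u \<in> verts t" "v \<in> verts t" "collapse W s v = b" for u v b
    using that
  proof (induction arbitrary: v)
    case base
    then show ?case using same by simp
  next
    case (step b c)
    from step.hyps(2) obtain e where e: "e \<in> edges t" "collapse W s ` e = {b, c}"
      by (auto simp: adj_def edges_contr)
    obtain x' y' where e': "e = {x', y'}" using simple_graph_cases[OF t e(1)] .
    obtain x y where xy: "{x, y} \<in> edges t" "collapse W s x = b" "collapse W s y = c"
      using e e' that[of x' y'] that[of y' x'] by (auto simp: doubleton_eq_iff insert_commute)
    note V = simple_graphD[OF t xy(1)]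
    have "(u, x) \<in> (adj (edges t))\<^sup>*" using step V xy by blast
    moreover have "(x, y) \<in> adj (edges t)" using xy by (simp add: adj_def)
    moreover have "(y, v) \<in> (adj (edges t))\<^sup>*" using same step V xy by blast
    ultimately show ?case by (meson rtrancl.rtrancl_into_rtrancl rtrancl_trans)
  qed
  moreover have "(collapse W s u, collapse W s v) \<in> (adj (edges (contr W s t)))\<^sup>*"
    if "u \<in> verts t" "v \<in> verts t" for u v
    using c that by (auto simp: joined_def collapse_def)
  ultimately show ?thesis using W assms(2) unfolding joined_def by blast
qed

lemma card_edges_split:
  assumes "simple_graph t"
  shows "card (edges t) = card (edges (restr W t)) + card {e \<in> edges t. \<not> e \<subseteq> W}"
  unfolding edges_restr
  by (subst card_Un_disjoint[symmetric])
    (use finite_edges[OF assms] in \<open>auto intro: arg_cong[where f = card]\<close>)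

lemma card_insert_Diff:
  assumes "finite V" "W \<subseteq> V" "s \<notin> V - W"
  shows "card (insert s (V - W)) + card W = card V + 1"
  using assms card_mono[OF assms(1,2)] by (simp add: card_Diff_subset finite_subset)

text \<open>Outside \<open>W\<close> there are |V| - |W| edges, one fewer than the contraction has
  vertices. Being connected, the contraction cannot have fewer edges than that, so no two outer
  edges are merged.\<close>

lemma contr_tree:
  assumes t: "t \<in> trees V" and W: "W \<subseteq> V" "restr W t \<in> trees W" and s: "s \<notin> V - W"
  shows "contr W s t \<in> trees (insert s (V - W))"
    and "inj_on ((`) (collapse W s)) {e \<in> edges t. \<not> e \<subseteq> W}"
proof -
  note T = treesD[OF t]
  let ?O = "{e \<in> edges t. \<not> e \<subseteq> W}"
  have fin: "finite ?O" using finite_edges[OF T(2)] by simp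
  have simple: "simple_graph (contr W s t)" using T s by (simp add: simple_graph_contr)
  have j: "joined (insert s (V - W)) (edges (contr W s t))"
    using T W treesD(5)[OF W(2)] by (intro joined_contr) auto
  have ge: "card (insert s (V - W)) \<le> card (edges (contr W s t)) + 1"
    using joined_card_ge[OF simple] j T by simp
  have le: "card (edges (contr W s t)) \<le> card ?O"
    unfolding edges_contr using fin by (rule card_image_le)
  have "card (edges t) + 1 = card V" "card (edges (restr W t)) + 1 = card W"
    using t W by (auto simp: trees_iff)
  with card_edges_split[OF T(2), of W] card_insert_Diff[OF T(4) W(1) s]
  have "card (insert s (V - W)) = card ?O + 1" by linarith
  with ge le have eq: "card (edges (contr W s t)) = card ?O" by linarith
  then show "inj_on ((`) (collapse W s)) ?O"
    using fin by (simp add: edges_contr eq_card_imp_inj_on)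
  show "contr W s t \<in> trees (insert s (V - W))"
    using simple j T eq \<open>card (insert s (V - W)) = card ?O + 1\<close> by (simp add: trees_iff)
qed

text \<open>The same count read backwards. Injectivity excludes cycles through \<open>W\<close>:
  distinct outer edges with the same image differ only in their ends in \<open>W\<close>, and these
  are joined inside \<open>W\<close>.\<close>

lemma tree_if_contr:
  assumes t: "simple_graph t" "verts t = V" and W: "W \<subseteq> V" "restr W t \<in> trees W"
    and s: "s \<notin> V - W" and c: "contr W s t \<in> trees (insert s (V - W))"
    and inj: "inj_on ((`) (collapse W s)) {e \<in> edges t. \<not> e \<subseteq> W}"
  shows "t \<in> trees V"
proof -
  have "card (edges (contr W s t)) = card {e \<in> edges t. \<not> e \<subseteq> W}"
    unfolding edges_contr using inj by (rule card_image)
  moreover have "finite V" using t by (auto simp: simple_graph_def)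
  moreover have "joined V (edges t)"
    using joined_if_joined_contr[OF t(1), of W s] t W s c by (auto simp: trees_iff)
  ultimately show ?thesis
    using card_edges_split[OF t(1), of W] card_insert_Diff[of V W s] t W s c
    by (simp add: trees_iff)
qed

text \<open>Taking a minor of a contraction selects edges, maps them and selects again. Moving the
  second selection in front of the map allows two such composites to be compared on the edges of the
  original graph.\<close>

lemma filter_image_filter:
  assumes "\<And>x. x \<in> A \<Longrightarrow> P x \<and> Q (f x) \<longleftrightarrow> R x"
  shows "{y \<in> f ` {x \<in> A. P x}. Q y} = f ` {x \<in> A. R x}"
  using assms by blast

section \<open>Commutation of restrictions and contractions\<close>

lemma restr_restr: "W' \<subseteq> W \<Longrightarrow> restr W' (restr W t) = restr W' t"
  by (auto simp: restr_def)

text \<open>After the contraction of \<open>W'\<close>, the set \<open>insert s (W - W')\<close>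
  plays the role of \<open>W\<close>: by the condition on \<open>s\<close>, an edge lies in
  \<open>W\<close> exactly if its image lies in that set.\<close>

lemma contr_restr:
  assumes "simple_graph t" "W' \<subseteq> W" "W \<subseteq> verts t" "s \<notin> verts t - W'"
  shows "contr W' s (restr W t) = restr (insert s (W - W')) (contr W' s t)"
proof -
  have "e \<subseteq> W \<longleftrightarrow> collapse W' s ` e \<subseteq> insert s (W - W')" if "e \<in> edges t" for e
    using simple_graph_edge_subset[OF assms(1) that] assms(2-4)
    by (auto simp: collapse_def split: if_splits)
  then have "(`) (collapse W' s) ` {e \<in> edges (restr W t). \<not> e \<subseteq> W'}
      = {e \<in> (`) (collapse W' s) ` {e \<in> edges t. \<not> e \<subseteq> W'}. e \<subseteq> insert s (W - W')}"
    by (subst filter_image_filter[where R = "\<lambda>e. e \<subseteq> W \<and> \<not> e \<subseteq> W'"]) auto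
  then show ?thesis by (simp add: contr_def restr_def)
qed

lemma contr_contr:
  assumes "simple_graph t" "W' \<subseteq> W" "W \<subseteq> verts t" "s' \<notin> verts t - W'"
  shows "contr (insert s' (W - W')) s (contr W' s' t) = contr W s t"
proof -
  have c: "collapse (insert s' (W - W')) s (collapse W' s' v) = collapse W s v" if "v \<in> verts t" for v
    using that assms by (auto simp: collapse_def)
  have "(\<not> e \<subseteq> W' \<and> \<not> collapse W' s' ` e \<subseteq> insert s' (W - W')) \<longleftrightarrow> \<not> e \<subseteq> W" if "e \<in> edges t" for e
    using simple_graph_edge_subset[OF assms(1) that] assms(2-4)
    by (auto simp: collapse_def split: if_splits)
  then have "{e \<in> edges (contr W' s' t). \<not> e \<subseteq> insert s' (W - W')}
      = (`) (collapse W' s') ` {e \<in> edges t. \<not> e \<subseteq> W}"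
    unfolding edges_contr by (intro filter_image_filter) blast
  moreover have "collapse (insert s' (W - W')) s ` collapse W' s' ` e = collapse W s ` e"
    if "e \<in> edges t" for e
    using simple_graph_edge_subset[OF assms(1) that] c by (auto simp: image_image intro!: image_cong)
  ultimately have "edges (contr (insert s' (W - W')) s (contr W' s' t)) = edges (contr W s t)"
    by (simp add: edges_contr image_image cong: image_cong_simp)
  moreover have "verts (contr (insert s' (W - W')) s (contr W' s' t)) = verts (contr W s t)"
    using assms by auto
  ultimately show ?thesis by (simp add: prod_eq_iff)
qed

lemma restr_contr:
  assumes "simple_graph t" "W' \<inter> W = {}" "s' \<notin> W"
  shows "restr W (contr W' s' t) = restr W t"
proof -
  have sub: "collapse W' s' ` e \<subseteq> W \<longleftrightarrow> e \<subseteq> W" for e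
    using assms by (auto simp: collapse_def split: if_splits)
  have id: "collapse W' s' ` e = e" if "e \<subseteq> W" for e
    using assms that by (force simp: collapse_def)
  have "e \<in> edges (contr W' s' t) \<and> e \<subseteq> W \<longleftrightarrow> e \<in> edges t \<and> e \<subseteq> W" for e
  proof
    assume e: "e \<in> edges t \<and> e \<subseteq> W"
    \<comment> \<open>The empty set would lie in both \<open>W\<close> and \<open>W'\<close>; being
      nonempty, an edge inside \<open>W\<close> is not dropped when \<open>W'\<close> is
      contracted.\<close>
    moreover have "e \<noteq> {}" using e assms(1) by (auto elim: simple_graph_cases)
    ultimately have "\<not> e \<subseteq> W'" using assms(2) by blast
    with e show "e \<in> edges (contr W' s' t) \<and> e \<subseteq> W"
      unfolding edges_contr using id by (metis (mono_tags, lifting) image_eqI mem_Collect_eq)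
  qed (auto simp: edges_contr sub id)
  then show ?thesis by (simp add: restr_def)
qed

lemma contr_commute:
  assumes "W' \<inter> W = {}" "s' \<notin> W" "s \<notin> W'" "s \<noteq> s'"
  shows "contr W s (contr W' s' t) = contr W' s' (contr W s t)"
proof -
  \<comment> \<open>Collapsing \<open>A\<close> to a point outside \<open>B\<close> does not change
    which sets lie in \<open>B\<close>, so in either order the same edges are dropped.\<close>
  have sub: "collapse A a ` e \<subseteq> B \<longleftrightarrow> e \<subseteq> B" if "A \<inter> B = {}" "a \<notin> B" for A B a and e :: "'a set"
    using that by (auto simp: collapse_def split: if_splits)
  have "collapse W s ` collapse W' s' ` e = collapse W' s' ` collapse W s ` e" for e
    using assms by (auto simp: image_image collapse_def intro!: image_cong)
  moreover have "{e \<in> edges (contr W' s' t). \<not> e \<subseteq> W}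
      = (`) (collapse W' s') ` {e \<in> edges t. \<not> e \<subseteq> W \<and> \<not> e \<subseteq> W'}"
    unfolding edges_contr using sub[of W' W s'] assms by (intro filter_image_filter) blast
  moreover have "{e \<in> edges (contr W s t). \<not> e \<subseteq> W'}
      = (`) (collapse W s) ` {e \<in> edges t. \<not> e \<subseteq> W \<and> \<not> e \<subseteq> W'}"
    unfolding edges_contr using sub[of W W' s] assms by (intro filter_image_filter) blast
  ultimately have "edges (contr W s (contr W' s' t)) = edges (contr W' s' (contr W s t))"
    by (simp add: edges_contr image_image)
  moreover have "verts (contr W s (contr W' s' t)) = verts (contr W' s' (contr W s t))"
    using assms by auto
  ultimately show ?thesis by (simp add: prod_eq_iff)
qed

section \<open>Minors at all vertices and at a single vertex\<close>

lemma restr_verts: "simple_graph t \<Longrightarrow> restr (verts t) t = t"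
  by (auto simp: restr_def prod_eq_iff dest: simple_graph_edge_subset)

lemma contr_verts: "simple_graph t \<Longrightarrow> contr (verts t) s t = ({s}, {})"
  by (auto simp: contr_def dest: simple_graph_edge_subset)

lemma simple_graph_edge_not_singleton:
  assumes "simple_graph t" "e \<in> edges t"
  shows "\<not> e \<subseteq> {v}"
  using assms by (auto elim!: simple_graph_cases)

lemma restr_singleton: "simple_graph t \<Longrightarrow> restr {v} t = ({v}, {})"
  using simple_graph_edge_not_singleton by (fastforce simp: restr_def)

text \<open>No edge lies inside a single vertex, so nothing is dropped and contraction is mere
  renaming. This is the source of the right unit law.\<close>

lemma contr_singleton:
  assumes "simple_graph t" "v \<in> verts t"
  shows "contr {v} s t = map_graph (\<lambda>u. if u = v then s else u) t"
proof -
  have "collapse {v} s = (\<lambda>u. if u = v then s else u)" by (auto simp: collapse_def)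
  moreover have "{e \<in> edges t. \<not> e \<subseteq> {v}} = edges t"
    using simple_graph_edge_not_singleton[OF assms(1)] by blast
  moreover have "insert s (verts t - {v}) = (\<lambda>u. if u = v then s else u) ` verts t"
    using assms(2) by auto
  ultimately show ?thesis by (simp add: contr_def map_graph_def)
qed

lemma single_vertex_tree: "({v}, {}) \<in> trees {v}"
  by (simp add: trees_iff simple_graph_def joined_def)

section \<open>Relabelling\<close>

lemma verts_map_graph [simp]: "verts (map_graph \<sigma> t) = \<sigma> ` verts t"
  by (simp add: map_graph_def)

lemma edges_map_graph [simp]: "edges (map_graph \<sigma> t) = (`) \<sigma> ` edges t"
  by (simp add: map_graph_def)

lemma simple_graph_map:
  assumes "simple_graph t" "inj_on \<sigma> (verts t)"
  shows "simple_graph (map_graph \<sigma> t)"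
  unfolding simple_graph_def
proof (intro conjI ballI)
  show "finite (verts (map_graph \<sigma> t))" using assms by (simp add: simple_graph_def)
  fix e assume "e \<in> edges (map_graph \<sigma> t)"
  then obtain d where d: "d \<in> edges t" "e = \<sigma> ` d" by auto
  obtain u v where uv: "d = {u, v}" "u \<in> verts t" "v \<in> verts t" "u \<noteq> v"
    using simple_graph_cases[OF assms(1) d(1)] .
  then have "\<sigma> u \<noteq> \<sigma> v" "e = {\<sigma> u, \<sigma> v}" using d assms(2) by (simp_all add: inj_on_eq_iff)
  with uv show "\<exists>u\<in>verts (map_graph \<sigma> t). \<exists>v\<in>verts (map_graph \<sigma> t). u \<noteq> v \<and> e = {u, v}"
    by auto
qed

lemma inj_on_edges:
  assumes "simple_graph t" "inj_on \<sigma> (verts t)"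
  shows "inj_on ((`) \<sigma>) (edges t)"
  using inj_on_image_Pow[OF assms(2)] simple_graph_edges_Pow[OF assms(1)] by (rule inj_on_subset)

lemma adj_map_graph:
  assumes "(u, v) \<in> (adj (edges t))\<^sup>*"
  shows "(\<sigma> u, \<sigma> v) \<in> (adj (edges (map_graph \<sigma> t)))\<^sup>*"
  using assms
proof induction
  case (step y z)
  have "(\<sigma> y, \<sigma> z) \<in> adj (edges (map_graph \<sigma> t))"
    using step(2) by (auto simp: adj_def intro!: image_eqI[of _ _ "{y, z}"])
  with step show ?case by simp
qed simp

lemma map_graph_tree:
  assumes "t \<in> trees V" "inj_on \<sigma> V"
  shows "map_graph \<sigma> t \<in> trees (\<sigma> ` V)"
proof -
  note T = treesD[OF assms(1)]
  have "joined (\<sigma> ` V) (edges (map_graph \<sigma> t))"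
    using T(3) adj_map_graph[of _ _ t \<sigma>] by (auto simp: joined_def)
  moreover have "card (edges (map_graph \<sigma> t)) + 1 = card (\<sigma> ` V)"
    using assms inj_on_edges[of t \<sigma>] T by (simp add: card_image trees_iff)
  moreover have "simple_graph (map_graph \<sigma> t)"
    using simple_graph_map T assms(2) by metis
  ultimately show ?thesis using T by (simp add: trees_iff)
qed

lemma map_graph_cong:
  assumes "simple_graph t" "\<And>v. v \<in> verts t \<Longrightarrow> \<sigma> v = \<tau> v"
  shows "map_graph \<sigma> t = map_graph \<tau> t"
proof -
  have "\<sigma> ` e = \<tau> ` e" if "e \<in> edges t" for e
    using simple_graph_edge_subset[OF assms(1) that] assms(2) by (auto intro!: image_cong)
  then show ?thesis using assms(2) by (auto simp: map_graph_def intro!: image_cong)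
qed

lemma map_graph_id [simp]: "map_graph (\<lambda>v. v) t = t"
  by (simp add: map_graph_def)

lemma map_graph_comp: "map_graph (\<lambda>v. \<tau> (\<sigma> v)) t = map_graph \<tau> (map_graph \<sigma> t)"
  by (simp add: map_graph_def image_image)

lemma image_subset_image_iff:
  assumes "inj_on \<sigma> V" "A \<subseteq> V" "B \<subseteq> V"
  shows "\<sigma> ` A \<subseteq> \<sigma> ` B \<longleftrightarrow> A \<subseteq> B"
  using assms unfolding inj_on_def by blast

lemma restr_map:
  assumes "simple_graph t" "inj_on \<sigma> (verts t)" "W \<subseteq> verts t"
  shows "restr (\<sigma> ` W) (map_graph \<sigma> t) = map_graph \<sigma> (restr W t)"
proof -
  have "\<sigma> ` e \<subseteq> \<sigma> ` W \<longleftrightarrow> e \<subseteq> W" if "e \<in> edges t" for e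
    using image_subset_image_iff[OF assms(2) simple_graph_edge_subset[OF assms(1) that] assms(3)] .
  then have "{e \<in> (`) \<sigma> ` {e \<in> edges t. True}. e \<subseteq> \<sigma> ` W} = (`) \<sigma> ` {e \<in> edges t. e \<subseteq> W}"
    by (intro filter_image_filter) blast
  then show ?thesis by (simp add: prod_eq_iff)
qed

lemma collapse_map:
  assumes "inj_on \<sigma> V" "W \<subseteq> V" "v \<in> V" "\<And>v. v \<in> V - W \<Longrightarrow> \<tau> v = \<sigma> v" "\<tau> s = s'"
  shows "collapse (\<sigma> ` W) s' (\<sigma> v) = \<tau> (collapse W s v)"
  using assms by (cases "v \<in> W") (auto simp: collapse_def inj_on_image_mem_iff)

text \<open>The contracted graph has the vertex \<open>s\<close> in place of \<open>W\<close> and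
  needs a relabelling \<tau> of its own: it follows \<sigma> outside \<open>W\<close> but may send
  \<open>s\<close> elsewhere than \<sigma> does, even if \<open>s\<close> is a vertex of
  \<open>W\<close>.\<close>

lemma contr_map:
  assumes "simple_graph t" "inj_on \<sigma> (verts t)" "W \<subseteq> verts t"
    and \<tau>: "\<And>v. v \<in> verts t - W \<Longrightarrow> \<tau> v = \<sigma> v" "\<tau> s = s'"
  shows "contr (\<sigma> ` W) s' (map_graph \<sigma> t) = map_graph \<tau> (contr W s t)"
proof -
  have [simp]: "collapse (\<sigma> ` W) s' (\<sigma> v) = \<tau> (collapse W s v)" if "v \<in> verts t" for v
    using collapse_map[OF assms(2,3) that] \<tau> by blast
  have sub: "\<sigma> ` e \<subseteq> \<sigma> ` W \<longleftrightarrow> e \<subseteq> W" if "e \<in> edges t" for e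
    using image_subset_image_iff[OF assms(2) simple_graph_edge_subset[OF assms(1) that] assms(3)] .
  then have "{e \<in> (`) \<sigma> ` {e \<in> edges t. True}. \<not> e \<subseteq> \<sigma> ` W} = (`) \<sigma> ` {e \<in> edges t. \<not> e \<subseteq> W}"
    by (intro filter_image_filter) blast
  moreover have "collapse (\<sigma> ` W) s' ` \<sigma> ` e = \<tau> ` collapse W s ` e" if "e \<in> edges t" for e
    using simple_graph_edge_subset[OF assms(1) that] by (force simp: image_image intro!: image_cong)
  ultimately have "edges (contr (\<sigma> ` W) s' (map_graph \<sigma> t)) = edges (map_graph \<tau> (contr W s t))"
    by (simp add: edges_contr image_image cong: image_cong_simp)
  moreover have "\<sigma> ` verts t - \<sigma> ` W = \<tau> ` (verts t - W)"
  proof -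
    have "\<sigma> ` verts t - \<sigma> ` W = \<sigma> ` (verts t - W)"
      using assms(2,3) by (simp add: inj_on_image_set_diff)
    then show ?thesis using \<tau>(1) by (auto intro!: image_cong)
  qed
  ultimately show ?thesis using \<tau>(2) by (simp add: prod_eq_iff)
qed

section \<open>Gates\<close>

text \<open>The gate of \<open>W\<close> as seen from \<open>r\<close> is the first vertex of \<open>W\<close> on the path from \<open>r\<close> to \<open>W\<close>. In
  a rooted tree it is the root which \<open>W\<close> inherits.\<close>

definition adj_avoiding :: "'a set \<Rightarrow> 'a set set \<Rightarrow> ('a \<times> 'a) set" where
  "adj_avoiding W E = {(u, v). {u, v} \<in> E \<and> u \<notin> W}"

text \<open>Only the source of each step has to avoid \<open>W\<close>. A walk may thus enter
  \<open>W\<close> but never continue from there, and its end is the first vertex of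
  \<open>W\<close> that it meets.\<close>

definition is_gate :: "'a set \<Rightarrow> 'a graph \<Rightarrow> 'a \<Rightarrow> 'a \<Rightarrow> bool" where
  "is_gate W t r w \<longleftrightarrow> w \<in> W \<and> (r, w) \<in> (adj_avoiding W (edges t))\<^sup>*"

definition gate :: "'a set \<Rightarrow> 'a graph \<Rightarrow> 'a \<Rightarrow> 'a" where
  "gate W t r = (THE w. is_gate W t r w)"

section \<open>Gates under contraction, restriction and relabelling\<close>

lemma adj_avoiding_contr:
  assumes t: "simple_graph t" and s: "s \<notin> verts t - W'" and "W' \<subseteq> W"
    and "(u, v) \<in> (adj_avoiding W (edges t))\<^sup>*"
  shows "(collapse W' s u, collapse W' s v)
    \<in> (adj_avoiding (insert s (W - W')) (edges (contr W' s t)))\<^sup>*"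
  using assms(4)
proof induction
  case (step y z)
  then have yz: "{y, z} \<in> edges t" "y \<notin> W" by (auto simp: adj_avoiding_def)
  with assms have y: "y \<notin> W'" "y \<noteq> s" using simple_graphD(1)[OF t yz(1)] by auto
  with yz have "{collapse W' s y, collapse W' s z} \<in> edges (contr W' s t)"
    by (intro edge_contr) auto
  with y yz have "(collapse W' s y, collapse W' s z)
      \<in> adj_avoiding (insert s (W - W')) (edges (contr W' s t))"
    by (auto simp: adj_avoiding_def)
  with step show ?case by simp
qed simp

text \<open>For \<open>W'\<close> inside \<open>W\<close>, no step of the walk to the gate starts in
  \<open>W'\<close>, so none of its edges is dropped by the contraction.\<close>

lemma is_gate_contr:
  assumes "simple_graph t" "s \<notin> verts t - W'" "W' \<subseteq> W" "is_gate W t r w"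
  shows "is_gate (insert s (W - W')) (contr W' s t) (collapse W' s r) (collapse W' s w)"
  using adj_avoiding_contr[OF assms(1-3)] assms(4) by (auto simp: is_gate_def collapse_def)

text \<open>Here the walk may run through \<open>W'\<close>. Its steps inside \<open>W'\<close>
  shrink to pauses at \<open>s\<close>, and \<open>s \<notin> W\<close> keeps it from entering
  \<open>W\<close> too early.\<close>

lemma is_gate_contr_disjoint:
  assumes "simple_graph t" "s \<notin> W" "W' \<inter> W = {}" "is_gate W t r w"
  shows "is_gate W (contr W' s t) (collapse W' s r) w"
proof -
  have "(collapse W' s r, collapse W' s w) \<in> (adj_avoiding W (edges (contr W' s t)))\<^sup>*"
    if "(r, w) \<in> (adj_avoiding W (edges t))\<^sup>*" for r w
    using that
  proof induction
    case (step y z)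
    then have yz: "{y, z} \<in> edges t" "y \<notin> W" by (auto simp: adj_avoiding_def)
    show ?case
    proof (cases "{y, z} \<subseteq> W'")
      case False
      with yz have "{collapse W' s y, collapse W' s z} \<in> edges (contr W' s t)"
        by (intro edge_contr)
      with yz assms(2) have "(collapse W' s y, collapse W' s z) \<in> adj_avoiding W (edges (contr W' s t))"
        by (auto simp: adj_avoiding_def collapse_def)
      with step show ?thesis by simp
    qed (use step in simp)
  qed simp
  moreover have "collapse W' s w = w" using assms(3,4) by (auto simp: is_gate_def collapse_def)
  ultimately show ?thesis using assms(4) unfolding is_gate_def by metis
qed

text \<open>No step of the walk to \<open>W\<close> starts in the smaller set \<open>W'\<close>, and
  the walk inside \<open>W\<close> continues it. So a root inherited in two stages is the one
  inherited directly.\<close>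

lemma is_gate_restr:
  assumes "W' \<subseteq> W" "is_gate W t r g" "is_gate W' (restr W t) g w"
  shows "is_gate W' t r w"
proof -
  have "(adj_avoiding W (edges t))\<^sup>* \<subseteq> (adj_avoiding W' (edges t))\<^sup>*"
    "(adj_avoiding W' (edges (restr W t)))\<^sup>* \<subseteq> (adj_avoiding W' (edges t))\<^sup>*"
    using assms(1) by (auto intro!: rtrancl_mono simp: adj_avoiding_def)
  with assms(2,3) show ?thesis unfolding is_gate_def by (meson rtrancl_trans subsetD)
qed

lemma is_gate_map:
  assumes "simple_graph t" "inj_on \<sigma> (verts t)" "W \<subseteq> verts t" "is_gate W t r w"
  shows "is_gate (\<sigma> ` W) (map_graph \<sigma> t) (\<sigma> r) (\<sigma> w)"
proof -
  have "(\<sigma> u, \<sigma> v) \<in> (adj_avoiding (\<sigma> ` W) (edges (map_graph \<sigma> t)))\<^sup>*"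
    if "(u, v) \<in> (adj_avoiding W (edges t))\<^sup>*" for u v
    using that
  proof induction
    case (step y z)
    then have yz: "{y, z} \<in> edges t" "y \<notin> W" by (auto simp: adj_avoiding_def)
    have "\<sigma> y \<notin> \<sigma> ` W"
      using simple_graphD(1)[OF assms(1) yz(1)] yz(2) assms(2,3) by (simp add: inj_on_image_mem_iff)
    with yz have "(\<sigma> y, \<sigma> z) \<in> adj_avoiding (\<sigma> ` W) (edges (map_graph \<sigma> t))"
      by (auto simp: adj_avoiding_def intro!: image_eqI[of _ _ "{y, z}"])
    with step show ?case by simp
  qed simp
  with assms(4) show ?thesis by (auto simp: is_gate_def)
qed

lemma is_gate_self: "r \<in> W \<Longrightarrow> is_gate W t r r"
  by (simp add: is_gate_def)

text \<open>Going backwards along a walk that ends in \<open>W\<close>, the gate found so far is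
  kept until a vertex of \<open>W\<close> is met, which becomes the new gate.\<close>

lemma is_gate_exists:
  assumes "joined V (edges t)" "r \<in> V" "W \<subseteq> V" "W \<noteq> {}"
  obtains w where "is_gate W t r w"
proof -
  obtain w0 where w0: "w0 \<in> W" using assms(4) by blast
  then have "(r, w0) \<in> (adj (edges t))\<^sup>*" using assms by (auto simp: joined_def)
  then have "\<exists>w. is_gate W t r w"
  proof (induction rule: converse_rtrancl_induct)
    case base
    then show ?case using w0 is_gate_self by fast
  next
    case (step y z)
    then obtain w where w: "is_gate W t z w" by blast
    show ?case
    proof (cases "y \<in> W")
      case False
      with step(1) have "(y, z) \<in> adj_avoiding W (edges t)" by (simp add: adj_def adj_avoiding_def)
      with w show ?thesis unfolding is_gate_def by (meson converse_rtrancl_into_rtrancl)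
    qed (use is_gate_self in fast)
  qed
  then show thesis using that by blast
qed

text \<open>A path from \<open>x\<close> to \<open>y\<close> that misses \<open>s\<close> would form
  a cycle with the two edges at \<open>s\<close>.\<close>

lemma tree_neighbours_eq:
  assumes t: "t \<in> trees V" and s: "{x, s} \<in> edges t" "{y, s} \<in> edges t"
    and walk: "(r, x) \<in> (adj_avoiding {s} (edges t))\<^sup>*" "(r, y) \<in> (adj_avoiding {s} (edges t))\<^sup>*"
  shows "x = y"
proof (rule ccontr)
  assume "x \<noteq> y"
  note T = treesD[OF t]
  define E where "E = {e \<in> edges t. s \<notin> e}"
  \<comment> \<open>No step leaves \<open>s\<close>, so a walk with another end never visits
    \<open>s\<close> and uses only edges in \<open>E\<close>.\<close>
  have E: "(r, z) \<in> (adj E)\<^sup>*" if "(r, z) \<in> (adj_avoiding {s} (edges t))\<^sup>*" "z \<noteq> s" for z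
    using that
  proof induction
    case (step y z)
    then have "(y, z) \<in> adj E" "y \<noteq> s" by (auto simp: adj_avoiding_def adj_def E_def)
    with step show ?case by simp
  qed simp
  have ns: "x \<noteq> s" "y \<noteq> s" using simple_graphD(3)[OF T(2)] s by blast+
  have "(x, y) \<in> (adj E)\<^sup>*"
    using E[OF walk(1) ns(1)] E[OF walk(2) ns(2)] adj_rtrancl_sym by (meson rtrancl_trans)
  then obtain p where p: "p \<noteq> []" "distinct p" "successively (\<lambda>a b. (a, b) \<in> adj E) p"
    "hd p = x" "last p = y" "\<forall>z\<in>set p. (x, z) \<in> (adj E)\<^sup>*"
    using path_if_rtrancl by metis
  have out: "z \<in> V - {s}" if "(x, z) \<in> (adj E)\<^sup>*" for z
    using that
  proof induction
    case base
    then show ?case using ns simple_graphD(1)[OF T(2) s(1)] T(1) by simp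
  next
    case (step y z)
    then have "{y, z} \<in> edges t" "z \<noteq> s" by (auto simp: adj_def E_def)
    with simple_graphD(2)[OF T(2)] T(1) show ?case by blast
  qed
  have "successively (\<lambda>a b. {a, b} \<in> edges t) p"
    using p(3) by (rule successively_mono) (auto simp: adj_def E_def)
  then have "is_path t (s # p)"
    using p out s(1) simple_graphD(2)[OF T(2) s(1)] T(1)
    by (auto simp: is_path_def successively_Cons insert_commute)
  moreover have "length (s # p) \<ge> 3"
  proof -
    have "length p \<noteq> 0" "length p \<noteq> 1" using p \<open>x \<noteq> y\<close> by (auto simp: length_Suc_conv)
    then have "2 \<le> length p" by linarith
    then show ?thesis by simp
  qed
  moreover have "{last (s # p), hd (s # p)} \<in> edges t" using p s(2) by simp
  moreover have "acyclic_graph t" using t by (simp add: trees_def)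
  ultimately show False unfolding acyclic_graph_def by blast
qed

text \<open>Contracting \<open>W\<close> turns the last vertices before the two gates into
  neighbours of one vertex, both reached from the root without passing through it, so they coincide.
  As outer edges are not merged, the two edges into \<open>W\<close> coincide as well.\<close>

lemma is_gate_unique:
  assumes t: "t \<in> trees V" and W: "W \<subseteq> V" "restr W t \<in> trees W"
    and g: "is_gate W t r w" "is_gate W t r w'"
  shows "w = w'"
proof (cases "r \<in> W")
  case True
  have "w = r" if "is_gate W t r w" for w
    using that True unfolding is_gate_def
    by (auto elim: converse_rtranclE simp: adj_avoiding_def)
  from this[OF g(1)] this[OF g(2)] show ?thesis by simp
next
  case False
  note T = treesD[OF t]
  have w: "w \<in> W" using g by (simp add: is_gate_def)
  \<comment> \<open>The gate \<open>w\<close> itself serves as the contraction point, since the type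
    need not contain any vertex outside \<open>V\<close>.\<close>
  then have nw: "w \<notin> V - W" by simp
  note C = contr_tree[OF t W nw]
  have last: "\<exists>x. {x, w'} \<in> edges t \<and> x \<notin> W \<and> w' \<in> W \<and> {x, w} \<in> edges (contr W w t) \<and>
      (collapse W w r, x) \<in> (adj_avoiding {w} (edges (contr W w t)))\<^sup>*"
    if "is_gate W t r w'" for w'
  proof -
    have w': "w' \<in> W" "(r, w') \<in> (adj_avoiding W (edges t))\<^sup>*" using that by (auto simp: is_gate_def)
    with False obtain x where x: "(r, x) \<in> (adj_avoiding W (edges t))\<^sup>*" "(x, w') \<in> adj_avoiding W (edges t)"
      by (metis rtranclE)
    then have xW: "{x, w'} \<in> edges t" "x \<notin> W" by (auto simp: adj_avoiding_def)
    have "{collapse W w x, collapse W w w'} \<in> edges (contr W w t)"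
      using xW by (intro edge_contr) auto
    moreover have "(collapse W w r, collapse W w x) \<in> (adj_avoiding {w} (edges (contr W w t)))\<^sup>*"
      using adj_avoiding_contr[OF T(2) _ order.refl x(1), of w] w by simp
    ultimately show ?thesis using xW w' by auto
  qed
  obtain x where x: "{x, w} \<in> edges t" "x \<notin> W" "{x, w} \<in> edges (contr W w t)"
    "(collapse W w r, x) \<in> (adj_avoiding {w} (edges (contr W w t)))\<^sup>*"
    using last[OF g(1)] by blast
  obtain x' where x': "{x', w'} \<in> edges t" "w' \<in> W" "{x', w} \<in> edges (contr W w t)"
    "(collapse W w r, x') \<in> (adj_avoiding {w} (edges (contr W w t)))\<^sup>*"
    using last[OF g(2)] by blast
  have "x = x'" using tree_neighbours_eq[OF C(1) x(3) x'(3) x(4) x'(4)] .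
  then have "{x, w} = {x, w'}"
    using inj_onD[OF C(2), of "{x, w}" "{x, w'}"] x x' w by simp
  then show ?thesis by (metis doubleton_eq_iff)
qed

lemma gate_eqI:
  assumes "t \<in> trees V" "W \<subseteq> V" "restr W t \<in> trees W" "is_gate W t r w"
  shows "gate W t r = w"
  unfolding gate_def using is_gate_unique[OF assms(1-3)] assms(4) by blast

lemma is_gate_gate:
  assumes "t \<in> trees V" "W \<subseteq> V" "restr W t \<in> trees W" "r \<in> V"
  shows "is_gate W t r (gate W t r)"
proof -
  obtain w where "is_gate W t r w"
    using is_gate_exists[OF treesD(3)[OF assms(1)] assms(4,2)] treesD(5)[OF assms(3)] by blast
  with gate_eqI[OF assms(1-3)] show ?thesis by metis
qed

section \<open>Operads from restrictions and contractions\<close>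

lemma sum_fibres:
  assumes "finite S" "finite T" "g ` S \<subseteq> T" "\<And>u. u \<in> T \<Longrightarrow> F u = (\<Sum>t\<in>{t \<in> S. g t = u}. h t)"
  shows "(\<Sum>u\<in>T. F u) = (\<Sum>t\<in>S. h t)"
  using sum.group[OF assms(1-3)] assms(4) by (metis (no_types, lifting) sum.cong)

text \<open>
  The basis \<open>B V\<close> of \<open>P[V]\<close> consists of structures that can be restricted to \<open>W \<subseteq> V\<close> and in which \<open>W\<close>
  can be contracted to a point \<open>s\<close>; not every restriction is again a basis element. If \<open>t1 \<circ>\<^sub>s t2\<close> is
  the sum of all structures with restriction \<open>t2\<close> and contraction \<open>t1\<close>, then both sides of an
  associativity axiom are sums over structures with three prescribed minors, and the axiom reduces to
  the commutation of restrictions and contractions.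
\<close>

locale restriction_contraction =
  fixes B :: "'a set \<Rightarrow> 'b set"
    and res :: "'a set \<Rightarrow> 'b \<Rightarrow> 'b"
    and con :: "'a set \<Rightarrow> 'a \<Rightarrow> 'b \<Rightarrow> 'b"
    and rel :: "('a \<Rightarrow> 'a) \<Rightarrow> 'b \<Rightarrow> 'b"
    and unit :: "'a \<Rightarrow> 'b"
    and cmp :: "'a \<Rightarrow> 'b \<Rightarrow> 'b \<Rightarrow> ('b \<Rightarrow>\<^sub>0 'k::field_char_0)"
  assumes B_empty: "B {} = {}"
    and finite_B: "finite V \<Longrightarrow> finite (B V)"
    and unit_B: "unit v \<in> B {v}"
    and rel_unit: "rel \<sigma> (unit v) = unit (\<sigma> v)"
    and rel_B: "\<lbrakk>t \<in> B V; inj_on \<sigma> V\<rbrakk> \<Longrightarrow> rel \<sigma> t \<in> B (\<sigma> ` V)"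
    and rel_cong: "\<lbrakk>t \<in> B V; \<And>v. v \<in> V \<Longrightarrow> \<sigma> v = \<tau> v\<rbrakk> \<Longrightarrow> rel \<sigma> t = rel \<tau> t"
    and rel_id: "rel (\<lambda>v. v) t = t"
    and rel_comp: "rel (\<lambda>v. \<tau> (\<sigma> v)) t = rel \<tau> (rel \<sigma> t)"
    and cmp_eq:
      "\<lbrakk>finite V1; finite V2; s \<notin> V1; V1 \<inter> V2 = {}; t1 \<in> B (insert s V1); t2 \<in> B V2\<rbrakk>
        \<Longrightarrow> cmp s t1 t2 = (\<Sum>t | t \<in> B (V1 \<union> V2) \<and> res V2 t = t2 \<and> con V2 s t = t1. basis t)"
    and con_B:
      "\<lbrakk>t \<in> B V; W \<subseteq> V; s \<notin> V - W; res W t \<in> B W\<rbrakk> \<Longrightarrow> con W s t \<in> B (insert s (V - W))"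
    and res_B:
      "\<lbrakk>t \<in> B V; W' \<subseteq> W; W \<subseteq> V; s' \<notin> V - W'; res W' t \<in> B W';
        res (insert s' (W - W')) (con W' s' t) \<in> B (insert s' (W - W'))\<rbrakk> \<Longrightarrow> res W t \<in> B W"
    and res_res:
      "\<lbrakk>t \<in> B V; W' \<subseteq> W; W \<subseteq> V; res W t \<in> B W; res W' t \<in> B W' \<or> res W' (res W t) \<in> B W'\<rbrakk>
        \<Longrightarrow> res W' (res W t) = res W' t"
    and con_res:
      "\<lbrakk>t \<in> B V; W' \<subseteq> W; W \<subseteq> V; s' \<notin> V - W'; res W t \<in> B W; res W' t \<in> B W'\<rbrakk>
        \<Longrightarrow> con W' s' (res W t) = res (insert s' (W - W')) (con W' s' t)"
    and con_con:
      "\<lbrakk>t \<in> B V; W' \<subseteq> W; W \<subseteq> V; s' \<notin> V - W'\<rbrakk>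
        \<Longrightarrow> con (insert s' (W - W')) s (con W' s' t) = con W s t"
    and res_con:
      "\<lbrakk>t \<in> B V; W \<subseteq> V; W' \<subseteq> V; W' \<inter> W = {}; s' \<notin> V - W'; res W' t \<in> B W';
        res W t \<in> B W \<or> res W (con W' s' t) \<in> B W\<rbrakk> \<Longrightarrow> res W (con W' s' t) = res W t"
    and con_commute:
      "\<lbrakk>t \<in> B V; W \<subseteq> V; W' \<subseteq> V; W' \<inter> W = {}; s' \<notin> W; s \<notin> W'; s \<noteq> s'\<rbrakk>
        \<Longrightarrow> con W s (con W' s' t) = con W' s' (con W s t)"
    and res_rel:
      "\<lbrakk>t \<in> B V; W \<subseteq> V; inj_on \<sigma> V; res W t \<in> B W\<rbrakk> \<Longrightarrow> res (\<sigma> ` W) (rel \<sigma> t) = rel \<sigma> (res W t)"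
    and con_rel:
      "\<lbrakk>t \<in> B V; W \<subseteq> V; inj_on \<sigma> V; \<And>v. v \<in> V - W \<Longrightarrow> \<tau> v = \<sigma> v; \<tau> s = s'\<rbrakk>
        \<Longrightarrow> con (\<sigma> ` W) s' (rel \<sigma> t) = rel \<tau> (con W s t)"
    and res_all: "t \<in> B V \<Longrightarrow> res V t = t"
    and con_all: "t \<in> B V \<Longrightarrow> con V s t = unit s"
    and res_singleton: "\<lbrakk>t \<in> B V; v \<in> V\<rbrakk> \<Longrightarrow> res {v} t = unit v"
    and con_singleton: "\<lbrakk>t \<in> B V; v \<in> V\<rbrakk> \<Longrightarrow> con {v} s t = rel (\<lambda>u. if u = v then s else u) t"
begin

definition P :: "('a, 'k, 'b \<Rightarrow>\<^sub>0 'k) operad_data" where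
  "P = \<lparr>
     smult = free_smult,
     space = (\<lambda>V. free_on (B V)),
     relabel = (\<lambda>V \<sigma>. lin_ext (\<lambda>t. basis (rel \<sigma> t))),
     op_unit = (\<lambda>v. basis (unit v)),
     pcomp = (\<lambda>V1 s V2. bilin_ext (cmp s))\<rparr>"

abbreviation relabelling :: "('a \<Rightarrow> 'a) \<Rightarrow> ('b \<Rightarrow>\<^sub>0 'k) \<Rightarrow> ('b \<Rightarrow>\<^sub>0 'k)" where
  "relabelling \<sigma> \<equiv> lin_ext (\<lambda>t. basis (rel \<sigma> t))"

definition comps :: "'a \<Rightarrow> 'a set \<Rightarrow> 'a set \<Rightarrow> 'b \<Rightarrow> 'b \<Rightarrow> 'b set" where
  "comps s V1 V2 t1 t2 = {t \<in> B (V1 \<union> V2). res V2 t = t2 \<and> con V2 s t = t1}"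

lemma cmp_comps:
  "\<lbrakk>finite V1; finite V2; s \<notin> V1; V1 \<inter> V2 = {}; t1 \<in> B (insert s V1); t2 \<in> B V2\<rbrakk>
    \<Longrightarrow> cmp s t1 t2 = (\<Sum>t\<in>comps s V1 V2 t1 t2. basis t)"
  using cmp_eq by (simp add: comps_def)

section \<open>Species structure and relabelling of composites\<close>

lemma linear_species_P: "linear_species P"
proof (intro linear_species.intro linear_species_axioms.intro)
  show "vector_space (smult P)" by (simp add: P_def vector_space_free)
next
  fix V
  show "module.subspace (smult P) (space P V)"
    by (simp add: P_def subspace_free_on)
next
  fix V x and \<sigma> :: "'a \<Rightarrow> 'a" assume "inj_on \<sigma> V" "x \<in> space P V"
  then show "relabel P V \<sigma> x \<in> space P (\<sigma> ` V)"
    by (auto simp: P_def rel_B intro: lin_ext_in)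
next
  fix V and \<sigma> :: "'a \<Rightarrow> 'a"
  show "linear_map_on (smult P) (smult P) (space P V) (relabel P V \<sigma>)"
    by (simp add: linear_map_on_def P_def)
next
  fix V x and \<sigma> \<tau> :: "'a \<Rightarrow> 'a" assume eq: "\<And>v. v \<in> V \<Longrightarrow> \<sigma> v = \<tau> v" and x: "x \<in> space P V"
  from x have "x \<in> free_on (B V)" by (simp add: P_def)
  then have "relabelling \<sigma> x = relabelling \<tau> x"
    by (induction rule: free_on_induct) (auto simp: rel_cong[OF _ eq])
  then show "relabel P V \<sigma> x = relabel P V \<tau> x" by (simp add: P_def)
next
  fix V x assume "x \<in> space P V"
  then have "x \<in> free_on (B V)" by (simp add: P_def)
  then have "relabelling (\<lambda>v. v) x = x"
    by (induction rule: free_on_induct) (auto simp: rel_id)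
  then show "relabel P V (\<lambda>v. v) x = x" by (simp add: P_def)
next
  fix V x and \<sigma> \<tau> :: "'a \<Rightarrow> 'a" assume "x \<in> space P V"
  then have "x \<in> free_on (B V)" by (simp add: P_def)
  then have "relabelling (\<lambda>v. \<tau> (\<sigma> v)) x = relabelling \<tau> (relabelling \<sigma> x)"
    by (induction rule: free_on_induct) (auto simp: rel_comp)
  then show "relabel P V (\<lambda>v. \<tau> (\<sigma> v)) x = relabel P (\<sigma> ` V) \<tau> (relabel P V \<sigma> x)"
    by (simp add: P_def)
qed

text \<open>Only an inclusion, as the reverse one is the same statement for the inverse bijections.
  The composite is relabelled by \<sigma> on \<open>V1\<close> and \<tau> on \<open>V2\<close> glued
  together.\<close>

lemma comps_rel:
  assumes V: "s \<notin> V1" "V1 \<inter> V2 = {}"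
    and inj: "inj_on \<sigma> (insert s V1)" "inj_on \<tau> V2" "\<sigma> ` V1 \<inter> \<tau> ` V2 = {}"
    and t: "t2 \<in> B V2" "t \<in> comps s V1 V2 t1 t2"
  shows "rel (\<lambda>v. if v \<in> V1 then \<sigma> v else \<tau> v) t
    \<in> comps (\<sigma> s) (\<sigma> ` V1) (\<tau> ` V2) (rel \<sigma> t1) (rel \<tau> t2)"
proof -
  let ?\<rho> = "\<lambda>v. if v \<in> V1 then \<sigma> v else \<tau> v"
  have \<rho>: "inj_on ?\<rho> (V1 \<union> V2)"
    using inj by (intro inj_on_disjoint_Un) (auto intro: inj_on_subset)
  have V2: "?\<rho> v = \<tau> v" if "v \<in> V2" for v using that V(2) by auto
  then have im: "?\<rho> ` V2 = \<tau> ` V2" by (auto intro: image_cong)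
  have t': "t \<in> B (V1 \<union> V2)" "res V2 t = t2" "con V2 s t = t1" using t(2) by (auto simp: comps_def)
  have "rel ?\<rho> t \<in> B (?\<rho> ` (V1 \<union> V2))" using t'(1) \<rho> by (rule rel_B)
  moreover have "?\<rho> ` (V1 \<union> V2) = \<sigma> ` V1 \<union> \<tau> ` V2" unfolding image_Un im by simp
  moreover have "res (\<tau> ` V2) (rel ?\<rho> t) = rel \<tau> t2"
    using res_rel[OF t'(1) _ \<rho>, of V2] t t'(2) rel_cong[OF t(1) V2, of "\<lambda>v. v"] unfolding im by simp
  moreover have "con (\<tau> ` V2) (\<sigma> s) (rel ?\<rho> t) = rel \<sigma> t1"
  proof -
    \<comment> \<open>The law for contractions is applied with the glued map on the composite and
      with \<sigma> on its contraction, where \<open>s\<close> stands for \<open>V2\<close>.\<close>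
    have "\<sigma> v = ?\<rho> v" if "v \<in> V1 \<union> V2 - V2" for v using that by auto
    from con_rel[OF t'(1) Un_upper2 \<rho> this refl, of s] show ?thesis using t'(3) unfolding im by blast
  qed
  ultimately show ?thesis by (simp add: comps_def)
qed

lemma rel_inverse:
  assumes "t \<in> B V" "\<And>v. v \<in> V \<Longrightarrow> \<tau> (\<sigma> v) = v"
  shows "rel \<tau> (rel \<sigma> t) = t"
  using rel_cong[OF assms(1), of "\<lambda>v. \<tau> (\<sigma> v)" "\<lambda>v. v"] assms(2) by (simp add: rel_comp rel_id)

lemma comps_rel_bij:
  assumes V: "s \<notin> V1" "V1 \<inter> V2 = {}"
    and inj: "inj_on \<sigma> (insert s V1)" "inj_on \<tau> V2" "\<sigma> ` V1 \<inter> \<tau> ` V2 = {}"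
    and t: "t1 \<in> B (insert s V1)" "t2 \<in> B V2"
  shows "bij_betw (rel (\<lambda>v. if v \<in> V1 then \<sigma> v else \<tau> v)) (comps s V1 V2 t1 t2)
    (comps (\<sigma> s) (\<sigma> ` V1) (\<tau> ` V2) (rel \<sigma> t1) (rel \<tau> t2))"
proof -
  let ?\<rho> = "\<lambda>v. if v \<in> V1 then \<sigma> v else \<tau> v"
  \<comment> \<open>The two inverses are taken separately: \<open>s\<close> may lie in
    \<open>V2\<close>, and its image under \<sigma> in the image of \<open>V2\<close> under \<tau>,
    so there need not be one bijection extending both maps.\<close>
  define \<sigma>' \<tau>' where "\<sigma>' = inv_into (insert s V1) \<sigma>" and "\<tau>' = inv_into V2 \<tau>"
  let ?\<rho>' = "\<lambda>v. if v \<in> \<sigma> ` V1 then \<sigma>' v else \<tau>' v"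
  have \<sigma>': "\<sigma>' (\<sigma> v) = v" if "v \<in> insert s V1" for v using that inj(1) by (simp add: \<sigma>'_def)
  have \<tau>': "\<tau>' (\<tau> v) = v" if "v \<in> V2" for v using that inj(2) by (simp add: \<tau>'_def)
  have im: "\<sigma>' ` \<sigma> ` V1 = V1" "\<tau>' ` \<tau> ` V2 = V2" using \<sigma>' \<tau>' by (force simp: image_image)+
  have \<rho>1: "?\<rho>' (?\<rho> v) = v" if "v \<in> V1 \<union> V2" for v
    using that \<sigma>' \<tau>' inj(3) by auto
  have \<rho>2: "?\<rho> (?\<rho>' v) = v" if "v \<in> \<sigma> ` V1 \<union> \<tau> ` V2" for v
    using that \<sigma>' \<tau>' inj(3) V(2) by (auto simp: disjoint_iff)
  have "rel ?\<rho>' t \<in> comps s V1 V2 t1 t2"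
    if "t \<in> comps (\<sigma> s) (\<sigma> ` V1) (\<tau> ` V2) (rel \<sigma> t1) (rel \<tau> t2)" for t
  proof -
    have "\<sigma> s \<notin> \<sigma> ` V1" using V(1) inj(1) by (auto simp: inj_on_def)
    moreover have "inj_on \<sigma>' (insert (\<sigma> s) (\<sigma> ` V1))" "inj_on \<tau>' (\<tau> ` V2)"
      unfolding \<sigma>'_def \<tau>'_def by (rule inj_on_inv_into, force)+
    moreover have "rel \<sigma>' (rel \<sigma> t1) = t1" "rel \<tau>' (rel \<tau> t2) = t2"
      using rel_inverse[OF t(1)] rel_inverse[OF t(2)] \<sigma>' \<tau>' by auto
    ultimately show ?thesis
      using comps_rel[of "\<sigma> s" "\<sigma> ` V1" "\<tau> ` V2" \<sigma>' \<tau>' "rel \<tau> t2" t "rel \<sigma> t1"] inj that V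
        rel_B[OF t(2) inj(2)] im \<sigma>'[of s] by simp
  qed
  moreover have "rel ?\<rho>' (rel ?\<rho> t) = t" if "t \<in> comps s V1 V2 t1 t2" for t
    using that \<rho>1 by (intro rel_inverse[of t "V1 \<union> V2"]) (auto simp: comps_def)
  moreover have "rel ?\<rho> (rel ?\<rho>' t) = t"
    if "t \<in> comps (\<sigma> s) (\<sigma> ` V1) (\<tau> ` V2) (rel \<sigma> t1) (rel \<tau> t2)" for t
    using that \<rho>2 by (intro rel_inverse[of t "\<sigma> ` V1 \<union> \<tau> ` V2"]) (auto simp: comps_def)
  moreover note comps_rel[OF V inj t(2)]
  ultimately show ?thesis by (intro bij_betw_byWitness[where f' = "rel ?\<rho>'"]) auto
qed

lemma finite_comps: "finite V1 \<Longrightarrow> finite V2 \<Longrightarrow> finite (comps s V1 V2 t1 t2)"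
  by (simp add: comps_def finite_B)

text \<open>All structures in \<open>S\<close> have the minors \<open>x\<close>, \<open>y\<close>
  and \<open>z\<close>. The left side groups them by their contraction along \<open>V3\<close>, the
  right side by their restriction to \<open>V2 \<union> V3\<close>.\<close>

lemma cmp_sequential:
  assumes fin: "finite V1" "finite V2" "finite V3"
    and V: "V1 \<inter> V2 = {}" "V1 \<inter> V3 = {}" "V2 \<inter> V3 = {}" "s \<notin> V1" "s' \<notin> V1" "s' \<notin> V2"
    and x: "x \<in> B (insert s V1)" and y: "y \<in> B (insert s' V2)" and z: "z \<in> B V3"
  shows "bilin_ext (cmp s') (cmp s x y) (basis z) = bilin_ext (cmp s) (basis x) (cmp s' y z)"
proof -
  let ?V = "V1 \<union> V2 \<union> V3"
  define S where "S = {t \<in> B ?V. res V3 t = z \<and> res (insert s' V2) (con V3 s' t) = y \<and>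
    con (V2 \<union> V3) s t = x}"
  have finS: "finite S" using fin by (simp add: S_def finite_B)
  have d: "?V - V3 = V1 \<union> V2" "V2 \<union> V3 - V3 = V2" using V by auto
  have cc: "con (insert s' V2) s (con V3 s' t) = con (V2 \<union> V3) s t" if "t \<in> B ?V" for t
    using con_con[OF that, of V3 "V2 \<union> V3" s' s] V d by auto
  have "bilin_ext (cmp s') (cmp s x y) (basis z) = (\<Sum>u\<in>comps s V1 (insert s' V2) x y. cmp s' u z)"
    using cmp_comps[of V1 "insert s' V2" s x y] fin V x y by (simp add: bilin_ext_sum)
  also have "\<dots> = (\<Sum>t\<in>S. basis t)"
  proof (rule sum_fibres[where g = "con V3 s'"])
    show "con V3 s' ` S \<subseteq> comps s V1 (insert s' V2) x y"
    proof clarify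
      fix t assume t: "t \<in> S"
      then have "con V3 s' t \<in> B (insert s' (?V - V3))"
        using V z by (intro con_B) (auto simp: S_def)
      with t cc show "con V3 s' t \<in> comps s V1 (insert s' V2) x y"
        by (simp add: comps_def S_def d)
    qed
    fix u assume u: "u \<in> comps s V1 (insert s' V2) x y"
    have "{t \<in> S. con V3 s' t = u} = comps s' (V1 \<union> V2) V3 u z"
      using u cc by (auto simp: S_def comps_def)
    then show "cmp s' u z = (\<Sum>t\<in>{t \<in> S. con V3 s' t = u}. basis t)"
      using cmp_comps[of "V1 \<union> V2" V3 s' u z] fin V z u by (simp add: comps_def Int_Un_distrib2)
  qed (use fin finS finite_comps in auto)
  also have "\<dots> = (\<Sum>w\<in>comps s' V2 V3 y z. cmp s x w)"
  proof (rule sum_fibres[where g = "res (V2 \<union> V3)", symmetric])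
    \<comment> \<open>Used both ways: restrictions of elements of \<open>S\<close> are composites of
      \<open>y\<close> and \<open>z\<close>, and every structure that restricts to such a composite
      and contracts to \<open>x\<close> belongs to \<open>S\<close>.\<close>
    have key: "res (V2 \<union> V3) t \<in> comps s' V2 V3 y z \<longleftrightarrow>
        res V3 t = z \<and> res (insert s' V2) (con V3 s' t) = y"
      if t: "t \<in> B ?V" and w: "res (V2 \<union> V3) t \<in> B (V2 \<union> V3)" for t
    proof -
      have s: "s' \<notin> ?V - V3" using V by auto
      have sub: "V3 \<subseteq> V2 \<union> V3" "V2 \<union> V3 \<subseteq> ?V" by auto
      have "con V3 s' (res (V2 \<union> V3) t) = res (insert s' V2) (con V3 s' t)" if "res V3 t = z"
        using con_res[OF t sub s w] that z by (simp add: d)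
      moreover have "res V3 (res (V2 \<union> V3) t) = z \<longleftrightarrow> res V3 t = z"
        using res_res[OF t sub w] z by auto
      ultimately show ?thesis using w by (auto simp: comps_def)
    qed
    \<comment> \<open>This restriction is a basis element because both of its minors,
      \<open>z\<close> and \<open>y\<close>, are.\<close>
    have resB: "res (V2 \<union> V3) t \<in> B (V2 \<union> V3)" if "t \<in> S" for t
      using that V y z by (intro res_B[of t ?V V3 "V2 \<union> V3" s']) (auto simp: S_def d)
    show "res (V2 \<union> V3) ` S \<subseteq> comps s' V2 V3 y z"
    proof clarify
      fix t assume t: "t \<in> S"
      then show "res (V2 \<union> V3) t \<in> comps s' V2 V3 y z"
        using key[OF _ resB[OF t]] by (simp add: S_def)
    qed
    fix w assume w: "w \<in> comps s' V2 V3 y z"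
    have "{t \<in> S. res (V2 \<union> V3) t = w} = comps s V1 (V2 \<union> V3) x w"
    proof (intro subset_antisym subsetI)
      fix t assume t: "t \<in> comps s V1 (V2 \<union> V3) x w"
      then have "t \<in> B ?V" "res (V2 \<union> V3) t = w" "con (V2 \<union> V3) s t = x"
        by (auto simp: comps_def Un_assoc)
      moreover have "w \<in> B (V2 \<union> V3)" using w by (simp add: comps_def)
      ultimately show "t \<in> {t \<in> S. res (V2 \<union> V3) t = w}"
        using key[of t] w by (auto simp: S_def)
    qed (auto simp: S_def comps_def Un_assoc)
    then show "cmp s x w = (\<Sum>t\<in>{t \<in> S. res (V2 \<union> V3) t = w}. basis t)"
      using cmp_comps[of V1 "V2 \<union> V3" s x w] fin V x w by (simp add: comps_def Int_Un_distrib)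
  qed (use fin finS finite_comps in auto)
  also have "\<dots> = bilin_ext (cmp s) (basis x) (cmp s' y z)"
    using cmp_comps[of V2 V3 s' y z] fin V y z by (simp add: bilin_ext_sum)
  finally show ?thesis .
qed

text \<open>One side of the parallel axiom in a form that exchanging \<open>(s, V2, y)\<close> with
  \<open>(s', V3, z)\<close> changes only in the order of two disjoint contractions. The other side
  is then an instance.\<close>

lemma cmp_parallel_sum:
  assumes fin: "finite V1" "finite V2" "finite V3"
    and V: "V1 \<inter> V2 = {}" "V1 \<inter> V3 = {}" "V2 \<inter> V3 = {}"
    and s: "s \<noteq> s'" "s \<notin> V1" "s' \<notin> V1" "s' \<notin> V2" "s \<notin> V3"
    and x: "x \<in> B (insert s (insert s' V1))" and y: "y \<in> B V2" and z: "z \<in> B V3"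
  shows "bilin_ext (cmp s') (cmp s x y) (basis z)
    = (\<Sum>t | t \<in> B (V1 \<union> V2 \<union> V3) \<and> res V2 t = y \<and> res V3 t = z \<and> con V2 s (con V3 s' t) = x. basis t)"
    (is "_ = (\<Sum>t\<in>?S. basis t)")
proof -
  let ?V = "V1 \<union> V2 \<union> V3"
  have d: "?V - V3 = V1 \<union> V2" using V by auto
  have s': "s' \<notin> ?V - V3" using s by auto
  have r: "res V2 (con V3 s' t) = y \<longleftrightarrow> res V2 t = y" if "t \<in> B ?V" "res V3 t = z" for t
  proof -
    have "V2 \<subseteq> ?V" "V3 \<subseteq> ?V" "V3 \<inter> V2 = {}" using V by auto
    then show ?thesis using res_con[OF that(1) _ _ _ s', of V2] y z that(2) by auto
  qed
  have "bilin_ext (cmp s') (cmp s x y) (basis z) = (\<Sum>u\<in>comps s (insert s' V1) V2 x y. cmp s' u z)"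
    using cmp_comps[of "insert s' V1" V2 s x y] fin V s x y by (simp add: bilin_ext_sum)
  also have "\<dots> = (\<Sum>t\<in>?S. basis t)"
  proof (rule sum_fibres[where g = "con V3 s'"])
    show "con V3 s' ` ?S \<subseteq> comps s (insert s' V1) V2 x y"
    proof clarify
      fix t assume t: "t \<in> B ?V" "y = res V2 t" "z = res V3 t" "x = con V2 s (con V3 s' t)"
      then have "con V3 s' t \<in> B (insert s' (?V - V3))"
        using s' z by (intro con_B) auto
      with t r[OF t(1)] show "con V3 s' t \<in> comps s (insert s' V1) V2 (con V2 s (con V3 s' t)) (res V2 t)"
        by (simp add: comps_def d)
    qed
    fix u assume u: "u \<in> comps s (insert s' V1) V2 x y"
    have "{t \<in> ?S. con V3 s' t = u} = comps s' (V1 \<union> V2) V3 u z"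
      using u r by (auto simp: comps_def)
    then show "cmp s' u z = (\<Sum>t\<in>{t \<in> ?S. con V3 s' t = u}. basis t)"
      using cmp_comps[of "V1 \<union> V2" V3 s' u z] fin V s z u by (simp add: comps_def Int_Un_distrib2)
  qed (use fin finite_comps finite_B in auto)
  finally show ?thesis .
qed

lemma cmp_parallel:
  assumes fin: "finite V1" "finite V2" "finite V3"
    and V: "V1 \<inter> V2 = {}" "V1 \<inter> V3 = {}" "V2 \<inter> V3 = {}"
    and s: "s \<noteq> s'" "s \<notin> V1" "s' \<notin> V1" "s' \<notin> V2" "s \<notin> V3"
    and x: "x \<in> B (insert s (insert s' V1))" and y: "y \<in> B V2" and z: "z \<in> B V3"
  shows "bilin_ext (cmp s') (cmp s x y) (basis z) = bilin_ext (cmp s) (cmp s' x z) (basis y)"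
proof -
  have "con V2 s (con V3 s' t) = con V3 s' (con V2 s t)" if "t \<in> B (V1 \<union> V2 \<union> V3)" for t
    using con_commute[OF that, of V2 V3 s' s] V s by auto
  then have "{t. t \<in> B (V1 \<union> V2 \<union> V3) \<and> res V2 t = y \<and> res V3 t = z \<and> con V2 s (con V3 s' t) = x}
    = {t. t \<in> B (V1 \<union> V3 \<union> V2) \<and> res V3 t = z \<and> res V2 t = y \<and> con V3 s' (con V2 s t) = x}"
    by (auto simp: Un_ac)
  moreover have "V3 \<inter> V2 = {}" "x \<in> B (insert s' (insert s V1))" using V x by (auto simp: insert_commute)
  ultimately show ?thesis
    using cmp_parallel_sum[OF assms] cmp_parallel_sum[of V1 V3 V2 s' s x z y] fin V s y z by simp
qed

lemma cmp_unit_left: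
  assumes "finite V" "x \<in> B V"
  shows "cmp s (unit s) x = basis x"
proof -
  have "{t. t \<in> B ({} \<union> V) \<and> res V t = x \<and> con V s t = unit s} = {x}"
    using assms res_all con_all by auto
  then show ?thesis using cmp_eq[of "{}" V s "unit s" x] assms unit_B by simp
qed

text \<open>Contracting \<open>v\<close> to \<open>s\<close> is renaming, so the only structure with
  contraction \<open>x\<close> is \<open>x\<close> with \<open>s\<close> renamed back to
  \<open>v\<close>.\<close>

lemma cmp_unit_right:
  assumes "finite V" "s \<notin> V" "v \<notin> V" "x \<in> B (insert s V)"
  shows "cmp s x (unit v) = basis (rel (\<lambda>u. if u = s then v else u) x)"
proof -
  let ?f = "\<lambda>u. if u = s then v else u" and ?g = "\<lambda>u. if u = v then s else u"
  have inj: "inj_on ?f (insert s V)" using assms by (auto simp: inj_on_def)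
  have im: "?f ` insert s V = V \<union> {v}" using assms by auto
  have x': "rel ?f x \<in> B (V \<union> {v})" using rel_B[OF assms(4) inj] im by simp
  have gf: "rel ?g (rel ?f x) = x" using assms by (intro rel_inverse[OF assms(4)]) auto
  have fg: "rel ?f (rel ?g t) = t" if "t \<in> B (V \<union> {v})" for t
    using assms by (intro rel_inverse[OF that]) auto
  have "{t. t \<in> B (V \<union> {v}) \<and> res {v} t = unit v \<and> con {v} s t = x} = {rel ?f x}"
    using x' gf fg res_singleton con_singleton by auto
  then show ?thesis using cmp_eq[of V "{v}" s x "unit v"] assms unit_B by simp
qed

theorem operad_P: "operad P"
proof (intro operad.intro linear_species_P operad_axioms.intro)
  show "space P {} = {0}" by (simp add: P_def B_empty)
  show "op_unit P v \<in> space P {v}" for v by (simp add: P_def unit_B)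
  show "relabel P {v} \<sigma> (op_unit P v) = op_unit P (\<sigma> v)" for v \<sigma> by (simp add: P_def rel_unit)
next
  fix V1 V2 s x y
  assume V: "finite V1" "finite V2" "s \<notin> V1" "V1 \<inter> V2 = {}"
    and xy: "x \<in> space P (insert s V1)" "y \<in> space P V2"
  have "cmp s a b \<in> free_on (B (V1 \<union> V2))" if "a \<in> B (insert s V1)" "b \<in> B V2" for a b
    using cmp_comps[OF V that] by (auto simp: comps_def intro!: free_on_sum_basis)
  with xy show "pcomp P V1 s V2 x y \<in> space P (V1 \<union> V2)"
    by (auto simp: P_def intro: bilin_ext_in)
next
  fix V1 V2 s y
  show "linear_map_on (smult P) (smult P) (space P (insert s V1)) (\<lambda>x. pcomp P V1 s V2 x y)"
    by (simp add: linear_map_on_def P_def)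
next
  fix V1 V2 s x
  show "linear_map_on (smult P) (smult P) (space P V2) (pcomp P V1 s V2 x)"
    by (simp add: linear_map_on_def P_def)
next
  fix V1 V2 s x y and \<sigma> \<tau> :: "'a \<Rightarrow> 'a"
  assume V: "finite V1" "finite V2" "s \<notin> V1" "V1 \<inter> V2 = {}"
    and inj: "inj_on \<sigma> (insert s V1)" "inj_on \<tau> V2" "\<sigma> ` V1 \<inter> \<tau> ` V2 = {}"
    and xy: "x \<in> space P (insert s V1)" "y \<in> space P V2"
  let ?\<rho> = "\<lambda>v. if v \<in> V1 then \<sigma> v else \<tau> v"
  have *: "relabelling ?\<rho> (cmp s a b) = cmp (\<sigma> s) (rel \<sigma> a) (rel \<tau> b)"
    if "a \<in> B (insert s V1)" "b \<in> B V2" for a b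
  proof -
    have "\<sigma> s \<notin> \<sigma> ` V1" using V inj(1) by (auto simp: inj_on_def)
    moreover have "rel \<sigma> a \<in> B (insert (\<sigma> s) (\<sigma> ` V1))" using rel_B[OF that(1) inj(1)] by simp
    ultimately have "cmp (\<sigma> s) (rel \<sigma> a) (rel \<tau> b)
        = (\<Sum>t\<in>comps (\<sigma> s) (\<sigma> ` V1) (\<tau> ` V2) (rel \<sigma> a) (rel \<tau> b). basis t)"
      using V inj rel_B[OF that(2) inj(2)] by (intro cmp_comps) auto
    also have "\<dots> = (\<Sum>t\<in>comps s V1 V2 a b. basis (rel ?\<rho> t))"
      using comps_rel_bij[OF V(3,4) inj that] by (rule sum.reindex_bij_betw[symmetric])
    also have "\<dots> = relabelling ?\<rho> (cmp s a b)"
      using cmp_comps[OF V that] by (simp add: lin_ext_sum)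
    finally show ?thesis ..
  qed
  have "x \<in> free_on (B (insert s V1))" and y: "y \<in> free_on (B V2)" using xy by (simp_all add: P_def)
  then have "relabelling ?\<rho> (bilin_ext (cmp s) x y)
      = bilin_ext (cmp (\<sigma> s)) (relabelling \<sigma> x) (relabelling \<tau> y)"
  proof (induction x rule: free_on_induct)
    case (basis a)
    from y show ?case by (induction y rule: free_on_induct) (auto simp: * basis)
  qed auto
  then show "relabel P (V1 \<union> V2) ?\<rho> (pcomp P V1 s V2 x y)
      = pcomp P (\<sigma> ` V1) (\<sigma> s) (\<tau> ` V2) (relabel P (insert s V1) \<sigma> x) (relabel P V2 \<tau> y)"
    by (simp add: P_def)
next
  fix V1 V2 V3 s s' x y z
  assume V: "finite V1" "finite V2" "finite V3" "V1 \<inter> V2 = {}" "V1 \<inter> V3 = {}" "V2 \<inter> V3 = {}"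
    "s \<notin> V1" "s' \<notin> V1" "s' \<notin> V2"
    and "x \<in> space P (insert s V1)" "y \<in> space P (insert s' V2)" "z \<in> space P V3"
  then have "x \<in> free_on (B (insert s V1))"
    and y: "y \<in> free_on (B (insert s' V2))" and z: "z \<in> free_on (B V3)"
    by (simp_all add: P_def)
  then have "bilin_ext (cmp s') (bilin_ext (cmp s) x y) z = bilin_ext (cmp s) x (bilin_ext (cmp s') y z)"
  proof (induction x rule: free_on_induct)
    case x: (basis a)
    from y show ?case
    proof (induction y rule: free_on_induct)
      case y: (basis b)
      from z show ?case
        by (induction z rule: free_on_induct) (auto simp: cmp_sequential[OF V x(1) y(1)])
    qed auto
  qed auto
  then show "pcomp P (V1 \<union> V2) s' V3 (pcomp P V1 s (insert s' V2) x y) z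
      = pcomp P V1 s (V2 \<union> V3) x (pcomp P V2 s' V3 y z)"
    by (simp add: P_def)
next
  fix V1 V2 V3 s s' x y z
  assume V: "finite V1" "finite V2" "finite V3" "V1 \<inter> V2 = {}" "V1 \<inter> V3 = {}" "V2 \<inter> V3 = {}"
    "s \<noteq> s'" "s \<notin> V1" "s' \<notin> V1" "s' \<notin> V2" "s \<notin> V3"
    and "x \<in> space P (insert s (insert s' V1))" "y \<in> space P V2" "z \<in> space P V3"
  then have "x \<in> free_on (B (insert s (insert s' V1)))"
    and y: "y \<in> free_on (B V2)" and z: "z \<in> free_on (B V3)"
    by (simp_all add: P_def)
  then have "bilin_ext (cmp s') (bilin_ext (cmp s) x y) z = bilin_ext (cmp s) (bilin_ext (cmp s') x z) y"
  proof (induction x rule: free_on_induct)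
    case x: (basis a)
    from y show ?case
    proof (induction y rule: free_on_induct)
      case y: (basis b)
      from z show ?case
        by (induction z rule: free_on_induct) (auto simp: cmp_parallel[OF V x(1) y(1)])
    qed auto
  qed auto
  then show "pcomp P (V1 \<union> V2) s' V3 (pcomp P (insert s' V1) s V2 x y) z
      = pcomp P (V1 \<union> V3) s V2 (pcomp P (insert s V1) s' V3 x z) y"
    by (simp add: P_def)
next
  fix V s x assume V: "finite V" and "x \<in> space P V"
  then have "x \<in> free_on (B V)" by (simp add: P_def)
  then have "bilin_ext (cmp s) (basis (unit s)) x = x"
    by (induction rule: free_on_induct) (auto simp: cmp_unit_left[OF V])
  then show "pcomp P {} s V (op_unit P s) x = x" by (simp add: P_def)
next
  fix V s v x assume V: "finite V" "s \<notin> V" "v \<notin> V" and "x \<in> space P (insert s V)"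
  then have "x \<in> free_on (B (insert s V))" by (simp add: P_def)
  then have "bilin_ext (cmp s) x (basis (unit v)) = relabelling (\<lambda>u. if u = s then v else u) x"
    by (induction rule: free_on_induct) (auto simp: cmp_unit_right[OF V])
  then show "pcomp P V s {v} x (op_unit P v)
      = relabel P (insert s V) (\<lambda>u. if u = s then v else u) x"
    by (simp add: P_def)
qed

end

section \<open>The operad of trees\<close>

lemma edge_nonempty: "simple_graph t \<Longrightarrow> e \<in> edges t \<Longrightarrow> e \<noteq> {}"
  by (auto elim: simple_graph_cases)

text \<open>The summand of \<open>tree_comp\<close> for the choice \<open>h\<close>. Rooted
  composition produces the same graphs, for fewer choices.\<close>

definition graft :: "'a \<Rightarrow> 'a graph \<Rightarrow> 'a graph \<Rightarrow> ('a \<Rightarrow> 'a) \<Rightarrow> 'a graph" where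
  "graft s t1 t2 h = replace_vertex t1 s t2 {{n, h n} |n. n \<in> neighbours t1 s}"

locale tree_pair =
  fixes V1 V2 :: "'a set" and s :: 'a and t1 t2 :: "'a graph"
  assumes V: "s \<notin> V1" "V1 \<inter> V2 = {}"
    and t1: "t1 \<in> trees (insert s V1)" and t2: "t2 \<in> trees V2"
begin

abbreviation N :: "'a set" where "N \<equiv> neighbours t1 s"

lemmas T1 = treesD[OF t1] and T2 = treesD[OF t2]

section \<open>Edges of a grafted graph\<close>

lemma N_V1: "n \<in> N \<Longrightarrow> n \<in> V1"
  using simple_graphD[OF T1(2), of n s] T1(1) by (auto simp: neighbours_def)

lemma edge_V1: "e \<in> edges t1 \<Longrightarrow> s \<notin> e \<Longrightarrow> e \<subseteq> V1"
  using simple_graph_edge_subset[OF T1(2), of e] T1(1) by auto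

lemma collapse_V1: "e \<subseteq> V1 \<Longrightarrow> collapse V2 s ` e = e"
  using V(2) by (force simp: collapse_def)

lemma verts_graft: "verts (graft s t1 t2 h) = V1 \<union> V2"
  using T1(1) T2(1) V by (auto simp: graft_def replace_vertex_def)

lemma edges_graft:
  "edges (graft s t1 t2 h) = {e \<in> edges t1. s \<notin> e} \<union> edges t2 \<union> (\<lambda>n. {n, h n}) ` N"
  by (auto simp: graft_def replace_vertex_def)

lemma outer_edges_graft:
  "{e \<in> edges (graft s t1 t2 h). \<not> e \<subseteq> V2} = {e \<in> edges t1. s \<notin> e} \<union> (\<lambda>n. {n, h n}) ` N"
proof -
  have "\<not> e \<subseteq> V2" if "e \<in> edges t1" "s \<notin> e" for e
    using edge_nonempty[OF T1(2) that(1)] edge_V1[OF that] V(2) by blast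
  moreover have "e \<subseteq> V2" if "e \<in> edges t2" for e
    using simple_graph_edge_subset[OF T2(2) that] T2(1) by simp
  moreover have "\<not> {n, h n} \<subseteq> V2" if "n \<in> N" for n using N_V1[OF that] V(2) by auto
  ultimately show ?thesis unfolding edges_graft by blast
qed

lemma edges_at_s: "edges t1 = {e \<in> edges t1. s \<notin> e} \<union> (\<lambda>n. {n, s}) ` N"
proof -
  have "e \<in> (\<lambda>n. {n, s}) ` N" if e: "e \<in> edges t1" "s \<in> e" for e
  proof -
    obtain u v where "e = {u, v}" using simple_graph_cases[OF T1(2) e(1)] .
    with e(2) obtain n where "e = {n, s}" by (auto simp: insert_commute)
    with e show ?thesis by (auto simp: neighbours_def)
  qed
  then show ?thesis by (auto simp: neighbours_def)
qed

lemma graft_simple: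
  assumes "h \<in> N \<rightarrow>\<^sub>E V2"
  shows "simple_graph (graft s t1 t2 h)"
  unfolding simple_graph_def verts_graft
proof (intro conjI ballI)
  show "finite (V1 \<union> V2)" using T1(4) T2(4) by simp
  fix e assume "e \<in> edges (graft s t1 t2 h)"
  then consider "e \<in> edges t1" "s \<notin> e" | "e \<in> edges t2" | n where "n \<in> N" "e = {n, h n}"
    by (auto simp: edges_graft)
  then show "\<exists>u\<in>V1 \<union> V2. \<exists>v\<in>V1 \<union> V2. u \<noteq> v \<and> e = {u, v}"
  proof cases
    case 1
    obtain u v where "e = {u, v}" "u \<noteq> v" using simple_graph_cases[OF T1(2) 1(1)] .
    with edge_V1[OF 1] show ?thesis by blast
  next
    case 2
    obtain u v where "e = {u, v}" "u \<in> verts t2" "v \<in> verts t2" "u \<noteq> v"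
      using simple_graph_cases[OF T2(2) 2] .
    with T2(1) show ?thesis by blast
  next
    case 3
    then have "n \<in> V1" "h n \<in> V2" using assms N_V1 by auto
    moreover from this have "n \<noteq> h n" using V(2) by auto
    ultimately show ?thesis using 3(2) by (metis UnCI)
  qed
qed

text \<open>Each neighbour \<open>n\<close> receives exactly one edge into \<open>V2\<close>, so
  replacing \<open>{n, h n}\<close> by \<open>{n, s}\<close> loses nothing. The graft contracts to
  \<open>t1\<close> without merging edges and is therefore a tree.\<close>

lemma graft_in:
  assumes h: "h \<in> N \<rightarrow>\<^sub>E V2"
  shows "graft s t1 t2 h \<in> trees (V1 \<union> V2)" "restr V2 (graft s t1 t2 h) = t2"
    "contr V2 s (graft s t1 t2 h) = t1"
proof -
  let ?t = "graft s t1 t2 h"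
  have hV: "n \<in> V1" "n \<notin> V2" "h n \<in> V2" if "n \<in> N" for n using that h N_V1[OF that] V(2) by auto
  have c: "collapse V2 s ` {n, h n} = {n, s}" if "n \<in> N" for n using hV[OF that] by simp
  have "e \<subseteq> V2" if "e \<in> edges t2" for e
    using simple_graph_edge_subset[OF T2(2) that] T2(1) by simp
  moreover have "\<not> e \<subseteq> V2" if "e \<in> edges t1" "s \<notin> e" for e
    using edge_nonempty[OF T1(2) that(1)] edge_V1[OF that] V(2) by blast
  moreover have "\<not> {n, h n} \<subseteq> V2" if "n \<in> N" for n using hV[OF that] by simp
  ultimately have "{e \<in> edges ?t. e \<subseteq> V2} = edges t2" unfolding edges_graft by auto
  then show res: "restr V2 ?t = t2" using T2(1) by (simp add: prod_eq_iff)
  have "edges (contr V2 s ?t) = edges t1"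
  proof -
    have "(`) (collapse V2 s) ` {e \<in> edges t1. s \<notin> e} = {e \<in> edges t1. s \<notin> e}"
      by (simp add: collapse_V1 edge_V1 cong: image_cong_simp)
    moreover have "(\<lambda>n. collapse V2 s ` {n, h n}) ` N = (\<lambda>n. {n, s}) ` N"
      using c by (rule image_cong[OF refl])
    ultimately show ?thesis
      unfolding edges_contr outer_edges_graft image_Un image_image using edges_at_s by simp
  qed
  moreover have "verts (contr V2 s ?t) = verts t1"
    using T1(1) V by (auto simp: verts_graft)
  ultimately show con: "contr V2 s ?t = t1" by (simp add: prod_eq_iff)
  have inj: "inj_on ((`) (collapse V2 s)) {e \<in> edges ?t. \<not> e \<subseteq> V2}"
    unfolding outer_edges_graft
  proof (rule inj_onI)
    fix d e
    assume de: "d \<in> {e \<in> edges t1. s \<notin> e} \<union> (\<lambda>n. {n, h n}) ` N"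
      "e \<in> {e \<in> edges t1. s \<notin> e} \<union> (\<lambda>n. {n, h n}) ` N" "collapse V2 s ` d = collapse V2 s ` e"
    have "{n, s} \<noteq> e" if "s \<notin> e" for n e using that by blast
    moreover have "n = m" if "{n, s} = {m, s}" for n m using that by (auto simp: doubleton_eq_iff)
    ultimately show "d = e"
      using de c collapse_V1[OF edge_V1] by (elim UnE imageE CollectE) metis+
  qed
  show "?t \<in> trees (V1 \<union> V2)"
  proof (rule tree_if_contr[OF graft_simple[OF h] verts_graft, of V2 s])
    have "insert s (V1 \<union> V2 - V2) = insert s V1" using V by auto
    then show "contr V2 s ?t \<in> trees (insert s (V1 \<union> V2 - V2))" using con t1 by simp
  qed (use res con inj V t2 in auto)
qed

text \<open>The choice can be read off: the edges between \<open>V1\<close> and \<open>V2\<close>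
  are the sets \<open>{n, h n}\<close>, with \<open>n\<close> in \<open>V1\<close> and
  \<open>h n\<close> in \<open>V2\<close>.\<close>

lemma graft_inj: "inj_on (graft s t1 t2) (N \<rightarrow>\<^sub>E V2)"
proof (rule inj_onI)
  fix h h' assume h: "h \<in> N \<rightarrow>\<^sub>E V2" "h' \<in> N \<rightarrow>\<^sub>E V2" "graft s t1 t2 h = graft s t1 t2 h'"
  show "h = h'"
  proof (rule PiE_ext[OF h(1,2)])
    fix n assume n: "n \<in> N"
    then have n': "n \<in> V1" "n \<notin> V2" "h n \<in> V2" "h n \<notin> V1" using h(1) N_V1[OF n] V(2) by auto
    then have "{n, h n} \<in> {e \<in> edges (graft s t1 t2 h'). \<not> e \<subseteq> V2}"
      using n h(3)[symmetric] by (auto simp: edges_graft)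
    then have "{n, h n} \<in> (\<lambda>n. {n, h' n}) ` N"
      unfolding outer_edges_graft using edge_V1[of "{n, h n}"] n' by auto
    then obtain m where m: "m \<in> N" "{n, h n} = {m, h' m}" by blast
    moreover have "h' m \<in> V2" using h(2) m(1) by auto
    ultimately show "h n = h' n" using n' by (auto simp: doubleton_eq_iff)
  qed
qed

text \<open>Every edge \<open>{n, s}\<close> of \<open>t1\<close> lifts to an edge of
  \<open>t\<close> from \<open>n\<close> into \<open>V2\<close>, which defines the choice.
  Injectivity of the contraction on outer edges shows that \<open>t\<close> has no further edges
  between \<open>V1\<close> and \<open>V2\<close>.\<close>

lemma graft_surj:
  assumes t: "t \<in> trees (V1 \<union> V2)" and res: "restr V2 t = t2" and con: "contr V2 s t = t1"
  obtains h where "h \<in> N \<rightarrow>\<^sub>E V2" "t = graft s t1 t2 h"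
proof -
  note T = treesD[OF t]
  have sV: "s \<notin> (V1 \<union> V2) - V2" using V by auto
  have "restr V2 t \<in> trees V2" using res t2 by simp
  note inj = contr_tree(2)[OF t _ this sV]
  have E1: "edges t1 = (`) (collapse V2 s) ` {e \<in> edges t. \<not> e \<subseteq> V2}"
    unfolding con[symmetric] edges_contr ..
  have E2: "edges t2 = {e \<in> edges t. e \<subseteq> V2}" using res by auto
  have outer: "\<exists>a b. d = {a, b} \<and> a \<in> V1 \<and> b \<in> V1 \<union> V2" if d: "d \<in> edges t" "\<not> d \<subseteq> V2" for d
  proof -
    obtain u v where uv: "d = {u, v}" "u \<in> V1 \<union> V2" "v \<in> V1 \<union> V2"
      using simple_graph_cases[OF T(2) d(1), unfolded T(1)] .
    then have "u \<in> V1 \<or> v \<in> V1" using d(2) by auto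
    with uv show ?thesis by (metis insert_commute)
  qed
  have "\<exists>w. w \<in> V2 \<and> {n, w} \<in> edges t" if n: "n \<in> N" for n
  proof -
    have "{n, s} \<in> (`) (collapse V2 s) ` {e \<in> edges t. \<not> e \<subseteq> V2}"
      using n by (simp add: neighbours_def flip: E1)
    then obtain d where "d \<in> {e \<in> edges t. \<not> e \<subseteq> V2}" and d3: "{n, s} = collapse V2 s ` d"
      by (rule imageE)
    then have d: "d \<in> edges t" "\<not> d \<subseteq> V2" by simp_all
    then obtain a b where ab: "d = {a, b}" "a \<in> V1" "b \<in> V1 \<union> V2" using outer by blast
    have "n \<noteq> s" "a \<noteq> s" "a \<notin> V2" using N_V1[OF n] ab V by auto
    moreover from this have "{n, s} = {a, collapse V2 s b}" using d3 ab(1) by simp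
    ultimately have "n = a" "collapse V2 s b = s" by (metis doubleton_eq_iff)+
    moreover have "b \<in> V2" using \<open>collapse V2 s b = s\<close> ab(3) V(1) by (metis UnE collapse_simps(2))
    ultimately show ?thesis using ab(1) d(1) by auto
  qed
  then obtain g where g: "\<And>n. n \<in> N \<Longrightarrow> g n \<in> V2 \<and> {n, g n} \<in> edges t" by metis
  \<comment> \<open>The sum in \<open>tree_comp\<close> ranges over extensional functions, so the
    choice has to be undefined outside \<open>N\<close>.\<close>
  define h where "h = restrict g N"
  have h: "h \<in> N \<rightarrow>\<^sub>E V2" using g by (simp add: h_def)
  have hn: "{n, h n} \<in> edges t" "h n \<in> V2" if "n \<in> N" for n using g that by (auto simp: h_def)
  have sub: "e \<in> edges (graft s t1 t2 h)" if e: "e \<in> edges t" for e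
  proof (cases "e \<subseteq> V2")
    case True
    with e E2 show ?thesis by (simp add: edges_graft)
  next
    case False
    with e obtain a b where ab: "e = {a, b}" "a \<in> V1" "b \<in> V1 \<union> V2" using outer by blast
    have ce: "collapse V2 s ` e \<in> edges t1" using E1 e False by blast
    show ?thesis
    proof (cases "b \<in> V1")
      case True
      then have "e \<subseteq> V1" "s \<notin> e" using ab V(1) by auto
      with collapse_V1[of e] ce show ?thesis by (simp add: edges_graft)
    next
      case False
      with ab have b: "b \<in> V2" by simp
      have a: "a \<notin> V2" using ab V(2) by auto
      with ab b ce have "a \<in> N" by (simp add: neighbours_def)
      \<comment> \<open>Both edges are sent to \<open>{a, s}\<close>.\<close>
      moreover have "{a, b} = {a, h a}"
      proof (rule inj_onD[OF inj])
        show "collapse V2 s ` {a, b} = collapse V2 s ` {a, h a}"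
          using a b hn(2)[OF \<open>a \<in> N\<close>] by simp
      qed (use a e ab(1) hn(1)[OF \<open>a \<in> N\<close>] in simp_all)
      ultimately show ?thesis using ab by (auto simp: edges_graft)
    qed
  qed
  have "e \<in> edges t" if e: "e \<in> edges t1" "s \<notin> e" for e
  proof -
    obtain d where d: "d \<in> edges t" "e = collapse V2 s ` d" using E1 e by auto
    with e(2) have "collapse V2 s ` d = d" by (force simp: collapse_def)
    with d show ?thesis by simp
  qed
  with E2 hn(1) have "edges (graft s t1 t2 h) \<subseteq> edges t" by (auto simp: edges_graft)
  with sub have "t = graft s t1 t2 h"
    using T(1) verts_graft by (auto simp: prod_eq_iff)
  with h that show thesis by blast
qed

lemma graft_bij:
  "bij_betw (graft s t1 t2) (N \<rightarrow>\<^sub>E V2)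
    {t \<in> trees (V1 \<union> V2). restr V2 t = t2 \<and> contr V2 s t = t1}"
  unfolding bij_betw_def
proof (intro conjI graft_inj subset_antisym subsetI)
  fix t assume "t \<in> {t \<in> trees (V1 \<union> V2). restr V2 t = t2 \<and> contr V2 s t = t1}"
  then show "t \<in> graft s t1 t2 ` (N \<rightarrow>\<^sub>E V2)" using graft_surj by blast
qed (use graft_in in auto)

lemma tree_comp_eq:
  "tree_comp s t1 t2 = (\<Sum>t | t \<in> trees (V1 \<union> V2) \<and> restr V2 t = t2 \<and> contr V2 s t = t1. basis t)"
  unfolding tree_comp_def T2(1) using sum.reindex_bij_betw[OF graft_bij]
  by (simp add: graft_def)

end

text \<open>The laws relating minors are identities of simple graphs. Being a tree matters for
  closure under the operations and for the formula for composites.\<close>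

interpretation T: restriction_contraction trees restr contr map_graph "\<lambda>v. ({v}, {})"
  "tree_comp :: 'a \<Rightarrow> 'a graph \<Rightarrow> 'a graph \<Rightarrow> ('a graph \<Rightarrow>\<^sub>0 'k::field_char_0)"
proof
  show "trees {} = {}" by (auto dest: treesD)
  show "finite (trees V)" if "finite V" for V :: "'a set" using that by (rule finite_trees)
  show "({v}, {}) \<in> trees {v}" for v :: 'a by (rule single_vertex_tree)
  show "map_graph \<sigma> ({v}, {}) = ({\<sigma> v}, {})" for \<sigma> :: "'a \<Rightarrow> 'a" and v by (simp add: map_graph_def)
  show "map_graph (\<lambda>v. v) t = t" for t :: "'a graph" by simp
next
  fix V1 V2 s and t1 t2 :: "'a graph"
  assume "s \<notin> V1" "V1 \<inter> V2 = {}" "t1 \<in> trees (insert s V1)" "t2 \<in> trees V2"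
  then interpret tree_pair V1 V2 s t1 t2 by unfold_locales
  show "tree_comp s t1 t2 = (\<Sum>t | t \<in> trees (V1 \<union> V2) \<and> restr V2 t = t2 \<and> contr V2 s t = t1. basis t)"
    by (rule tree_comp_eq)
next
  fix V W' W s' and t :: "'a graph"
  assume t: "t \<in> trees V" and W: "W' \<subseteq> W" "W \<subseteq> V" and s': "s' \<notin> V - W'" and W': "restr W' t \<in> trees W'"
    and c: "restr (insert s' (W - W')) (contr W' s' t) \<in> trees (insert s' (W - W'))"
  note T = treesD[OF t]
  show "restr W t \<in> trees W"
  \<comment> \<open>Injectivity on the outer edges of the restriction is inherited from the whole
    tree \<open>t\<close>, where the edge count provides it.\<close>
  proof (rule tree_if_contr[of _ _ W' s'])
    show "simple_graph (restr W t)" using T W by (intro simple_graph_restr) auto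
    show "contr W' s' (restr W t) \<in> trees (insert s' (W - W'))"
      using c contr_restr[OF T(2) W(1), of s'] T(1) W s' by simp
    have "W' \<subseteq> V" using W by blast
    from contr_tree(2)[OF t this W' s']
    show "inj_on ((`) (collapse W' s')) {e \<in> edges (restr W t). \<not> e \<subseteq> W'}"
      by (rule inj_on_subset) auto
    show "restr W' (restr W t) \<in> trees W'" using W' by (simp add: restr_restr[OF W(1)])
  qed (use W s' in auto)
next
  fix \<sigma> :: "'a \<Rightarrow> 'a" and t V assume "t \<in> trees V" "inj_on \<sigma> V"
  then show "map_graph \<sigma> t \<in> trees (\<sigma> ` V)" by (rule map_graph_tree)
next
  fix V W and t :: "'a graph" and \<sigma> \<tau> :: "'a \<Rightarrow> 'a" and s s'
  assume t: "t \<in> trees V"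
  note T = treesD[OF t]
  show "map_graph \<sigma> t = map_graph \<tau> t" if "\<And>v. v \<in> V \<Longrightarrow> \<sigma> v = \<tau> v"
    using map_graph_cong[OF T(2), of \<sigma> \<tau>] that T(1) by simp
  show "restr (\<sigma> ` W) (map_graph \<sigma> t) = map_graph \<sigma> (restr W t)" if "W \<subseteq> V" "inj_on \<sigma> V"
    using restr_map[OF T(2)] that T(1) by simp
  show "contr (\<sigma> ` W) s' (map_graph \<sigma> t) = map_graph \<tau> (contr W s t)"
    if "W \<subseteq> V" "inj_on \<sigma> V" "\<And>v. v \<in> V - W \<Longrightarrow> \<tau> v = \<sigma> v" "\<tau> s = s'"
    using contr_map[OF T(2), of \<sigma> W \<tau> s s'] that T(1) by simp
  show "restr V t = t" "contr V s t = ({s}, {})"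
    using restr_verts[OF T(2)] contr_verts[OF T(2)] T(1) by simp_all
  show "restr {v} t = ({v}, {})" for v using restr_singleton[OF T(2)] .
  show "contr {v} s t = map_graph (\<lambda>u. if u = v then s else u) t" if "v \<in> V" for v
    using contr_singleton[OF T(2)] that T(1) by simp
next
  fix V W W' and t :: "'a graph" and s s'
  assume t: "t \<in> trees V"
  note T = treesD[OF t]
  show "contr W s t \<in> trees (insert s (V - W))" if "W \<subseteq> V" "s \<notin> V - W" "restr W t \<in> trees W"
    using contr_tree(1)[OF t that(1,3,2)] .
  show "contr W' s' (restr W t) = restr (insert s' (W - W')) (contr W' s' t)"
    if "W' \<subseteq> W" "W \<subseteq> V" "s' \<notin> V - W'"
    using contr_restr[OF T(2)] that T(1) by simp
  show "contr (insert s' (W - W')) s (contr W' s' t) = contr W s t"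
    if "W' \<subseteq> W" "W \<subseteq> V" "s' \<notin> V - W'"
    using contr_contr[OF T(2)] that T(1) by simp
  show "contr W s (contr W' s' t) = contr W' s' (contr W s t)"
    if "W' \<inter> W = {}" "s' \<notin> W" "s \<notin> W'" "s \<noteq> s'"
    using that by (rule contr_commute)
  show "restr W (contr W' s' t) = restr W t"
    if "W \<subseteq> V" "W' \<inter> W = {}" "s' \<notin> V - W'"
    using restr_contr[OF T(2)] that by blast
qed (simp_all add: map_graph_comp restr_restr)

lemma T_operad_eq: "T_operad = T.P"
  by (simp add: T_operad_def T.P_def)

section \<open>The operad of rooted trees\<close>

text \<open>If \<open>restr W t\<close> is not connected, the definite description in
  \<open>gate\<close> may be meaningless; the conditions in the laws for restrictions exclude this
  case.\<close>

definition rooted_restr :: "'a set \<Rightarrow> 'a rgraph \<Rightarrow> 'a rgraph" where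
  "rooted_restr W = (\<lambda>(t, r). (restr W t, gate W t r))"

definition rooted_contr :: "'a set \<Rightarrow> 'a \<Rightarrow> 'a rgraph \<Rightarrow> 'a rgraph" where
  "rooted_contr W s = (\<lambda>(t, r). (contr W s t, collapse W s r))"

lemma in_rooted_trees [simp]: "(t, r) \<in> rooted_trees V \<longleftrightarrow> t \<in> trees V \<and> r \<in> V"
  by (simp add: rooted_trees_def)

text \<open>Parents are defined by simple paths, gates by walks. A walk to \<open>u\<close> without
  a step out of \<open>v\<close> shortens to a path that misses \<open>v\<close>, and appending
  \<open>v\<close> to it gives the path from the root.\<close>

lemma parents_iff:
  assumes t: "t \<in> trees V" and r: "r \<in> V"
  shows "u \<in> parents (t, r) v \<longleftrightarrow> {u, v} \<in> edges t \<and> (r, u) \<in> (adj_avoiding {v} (edges t))\<^sup>*"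
proof
  assume "u \<in> parents (t, r) v"
  then obtain p where p: "is_path t (p @ [u, v])" "hd (p @ [u, v]) = r"
    by (auto simp: parents_def)
  have walk: "successively (\<lambda>x y. {x, y} \<in> edges t) (p @ [u])" and v: "v \<notin> set (p @ [u])"
    using p(1) by (auto simp: is_path_def successively_append_iff)
  have "successively (\<lambda>x y. (x, y) \<in> adj_avoiding {v} (edges t)) (p @ [u])"
    using walk by (rule successively_mono) (use v in \<open>auto simp: adj_avoiding_def\<close>)
  then have "(hd (p @ [u]), last (p @ [u])) \<in> (adj_avoiding {v} (edges t))\<^sup>*"
    by (intro rtrancl_if_path) auto
  moreover have "hd (p @ [u]) = r" using p(2) by (cases p) auto
  ultimately show "{u, v} \<in> edges t \<and> (r, u) \<in> (adj_avoiding {v} (edges t))\<^sup>*"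
    using p(1) by (auto simp: is_path_def successively_append_iff)
next
  note T = treesD[OF t]
  assume uv: "{u, v} \<in> edges t \<and> (r, u) \<in> (adj_avoiding {v} (edges t))\<^sup>*"
  let ?R = "adj_avoiding {v} (edges t)"
  have ne: "u \<noteq> v" and vV: "v \<in> V" using simple_graphD[OF T(2)] uv T(1) by blast+
  obtain p where p: "p \<noteq> []" "distinct p" "successively (\<lambda>a b. (a, b) \<in> ?R) p" "hd p = r"
    "last p = u" "\<forall>x\<in>set p. (r, x) \<in> ?R\<^sup>*"
    using path_if_rtrancl[of r u ?R] uv by blast
  have "?R\<^sup>* \<subseteq> (adj (edges t))\<^sup>*" by (auto intro!: rtrancl_mono simp: adj_avoiding_def adj_def)
  then have pV: "set p \<subseteq> V"
    using p(6) simple_graph_rtrancl_verts[OF T(2)] T(1) r by blast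
  have "v \<notin> set p"
  proof
    assume "v \<in> set p"
    then obtain xs ys where xs: "p = xs @ v # ys" by (meson split_list)
    with p(5) ne have "ys \<noteq> []" by auto
    then obtain y zs where "ys = y # zs" by (cases ys) auto
    with p(3) xs show False by (auto simp: successively_append_iff adj_avoiding_def)
  qed
  obtain q where q: "p = q @ [u]" using p(1,5) by (metis append_butlast_last_id)
  have "successively (\<lambda>a b. {a, b} \<in> edges t) p"
    using p(3) by (rule successively_mono) (auto simp: adj_avoiding_def)
  then have "is_path t (q @ [u, v])"
    using p(2) pV \<open>v \<notin> set p\<close> vV uv T(1) ne
    by (auto simp: is_path_def q successively_append_iff)
  moreover have "hd (q @ [u, v]) = r" using p(4) q by (cases q) auto
  ultimately show "u \<in> parents (t, r) v" by (auto simp: parents_def)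
qed

text \<open>A walk can be stopped at its first visit to \<open>n\<close>; the steps before do not
  start in \<open>n\<close>.\<close>

lemma adj_avoiding_insert:
  assumes "(r, n) \<in> (adj_avoiding W E)\<^sup>*"
  shows "(r, n) \<in> (adj_avoiding (insert n W) E)\<^sup>*"
  using assms
proof (induction rule: converse_rtrancl_induct)
  case (step y z)
  then show ?case
    by (cases "y = n") (auto simp: adj_avoiding_def intro: converse_rtrancl_into_rtrancl)
qed simp

text \<open>An edge thus counts as a subtree with a unique gate, and it is this gate that
  distinguishes its parent end from its child end.\<close>

lemma restr_edge_tree:
  assumes t: "simple_graph t" and e: "{m, n} \<in> edges t"
  shows "restr {m, n} t \<in> trees {m, n}"
proof -
  have "d = {m, n}" if d: "d \<in> edges t" "d \<subseteq> {m, n}" for d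
  proof -
    obtain u v where "d = {u, v}" "u \<noteq> v" using simple_graph_cases[OF t d(1)] .
    with d(2) show ?thesis by auto
  qed
  with e have E: "edges (restr {m, n} t) = {{m, n}}" by auto
  moreover have "m \<noteq> n" using simple_graphD(3)[OF t e] .
  moreover have "joined {m, n} {{m, n}}"
    unfolding joined_def adj_def by (auto simp: insert_commute)
  moreover have "simple_graph (restr {m, n} t)"
    using simple_graph_restr[OF t] simple_graphD[OF t e] by simp
  ultimately show ?thesis by (simp add: trees_iff)
qed

text \<open>A neighbour \<open>n\<close> of \<open>s\<close> is the parent of \<open>s\<close> if the path from the root enters the edge
  \<open>{n, s}\<close> at \<open>n\<close>, and a child if it enters at \<open>s\<close>.\<close>

lemma children_eq:
  assumes t: "t \<in> trees V" and r: "r \<in> V"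
  shows "children (t, r) s = neighbours t s - parents (t, r) s"
proof -
  note T = treesD[OF t]
  have child: "n \<in> children (t, r) s \<longleftrightarrow> {n, s} \<in> edges t \<and> (r, s) \<in> (adj_avoiding {n} (edges t))\<^sup>*" for n
    using parents_iff[OF t r, of s n] by (simp add: children_def insert_commute)
  have "(r, s) \<in> (adj_avoiding {n} (edges t))\<^sup>* \<longleftrightarrow> (r, n) \<notin> (adj_avoiding {s} (edges t))\<^sup>*"
    if n: "{n, s} \<in> edges t" for n
  proof -
    have sub: "{n, s} \<subseteq> V" using simple_graphD[OF T(2) n] T(1) by simp
    have tree: "restr {n, s} t \<in> trees {n, s}" using restr_edge_tree[OF T(2) n] .
    have g1: "is_gate {n, s} t r n \<longleftrightarrow> (r, n) \<in> (adj_avoiding {s} (edges t))\<^sup>*"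
    proof
      assume "is_gate {n, s} t r n"
      moreover have "(adj_avoiding {n, s} (edges t))\<^sup>* \<subseteq> (adj_avoiding {s} (edges t))\<^sup>*"
        by (auto intro!: rtrancl_mono simp: adj_avoiding_def)
      ultimately show "(r, n) \<in> (adj_avoiding {s} (edges t))\<^sup>*" by (auto simp: is_gate_def)
    qed (auto simp: is_gate_def dest: adj_avoiding_insert)
    have g2: "is_gate {n, s} t r s \<longleftrightarrow> (r, s) \<in> (adj_avoiding {n} (edges t))\<^sup>*"
    proof
      assume "is_gate {n, s} t r s"
      moreover have "(adj_avoiding {n, s} (edges t))\<^sup>* \<subseteq> (adj_avoiding {n} (edges t))\<^sup>*"
        by (auto intro!: rtrancl_mono simp: adj_avoiding_def)
      ultimately show "(r, s) \<in> (adj_avoiding {n} (edges t))\<^sup>*" by (auto simp: is_gate_def)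
    qed (auto simp: is_gate_def insert_commute dest: adj_avoiding_insert)
    have "n \<noteq> s" using simple_graphD(3)[OF T(2) n] .
    then have "\<not> (is_gate {n, s} t r n \<and> is_gate {n, s} t r s)"
      using is_gate_unique[OF t sub tree] by blast
    moreover have "is_gate {n, s} t r n \<or> is_gate {n, s} t r s"
      using is_gate_gate[OF t sub tree r] by (metis insertE is_gate_def singletonD)
    ultimately show ?thesis using g1 g2 by blast
  qed
  then show ?thesis
    using child parents_iff[OF t r] unfolding neighbours_def by blast
qed

text \<open>The parent is the last vertex before \<open>s\<close> on a walk that stops at
  \<open>s\<close>. Two such vertices would be neighbours of \<open>s\<close> that are joined
  without passing through \<open>s\<close>.\<close>

lemma parents_singleton:
  assumes t: "t \<in> trees V" and r: "r \<in> V" and s: "s \<in> V" "r \<noteq> s"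
  obtains p where "parents (t, r) s = {p}"
proof -
  have "{s} \<subseteq> V" using s by simp
  then have "is_gate {s} t r (gate {s} t r)"
    using is_gate_gate[OF t _ _ r] restr_singleton[OF treesD(2)[OF t]] single_vertex_tree by metis
  then have "(r, s) \<in> (adj_avoiding {s} (edges t))\<^sup>*" by (auto simp: is_gate_def)
  then obtain p where "(r, p) \<in> (adj_avoiding {s} (edges t))\<^sup>*" "(p, s) \<in> adj_avoiding {s} (edges t)"
    using s(2) by (metis rtranclE)
  then have p: "p \<in> parents (t, r) s" by (simp add: parents_iff[OF t r] adj_avoiding_def)
  moreover have "q = p" if "q \<in> parents (t, r) s" for q
    using that p tree_neighbours_eq[OF t, of q s p r] by (simp add: parents_iff[OF t r])
  ultimately show thesis using that by blast
qed

lemma parents_root: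
  assumes t: "t \<in> trees V" and r: "r \<in> V"
  shows "parents (t, r) r = {}"
proof -
  have "u = r" if "(r, u) \<in> (adj_avoiding {r} (edges t))\<^sup>*" for u
    using that by (auto elim: converse_rtranclE simp: adj_avoiding_def)
  then show ?thesis
    using parents_iff[OF t r] simple_graphD(3)[OF treesD(2)[OF t]] by blast
qed

section \<open>Rooted composites among the unrooted ones\<close>

locale rooted_tree_pair = tree_pair +
  fixes r1 r2 :: 'a
  assumes r1: "r1 \<in> insert s V1" and r2: "r2 \<in> V2"
begin

text \<open>A choice for the children extends to all neighbours of \<open>s\<close> by attaching the
  parent to \<open>r2\<close>. Rooted composition thus becomes the part of the unrooted one in which
  the parent chooses \<open>r2\<close>.\<close>

definition join :: "('a \<Rightarrow> 'a) \<Rightarrow> 'a \<Rightarrow> 'a" where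
  "join h = (\<lambda>n\<in>N. if n \<in> parents (t1, r1) s then r2 else h n)"

abbreviation comp_root :: 'a where "comp_root \<equiv> if r1 = s then r2 else r1"

lemma parents_N: "p \<in> parents (t1, r1) s \<Longrightarrow> p \<in> N"
  using parents_iff[OF t1 r1] by (simp add: neighbours_def)

lemma join_bij:
  "bij_betw join (children (t1, r1) s \<rightarrow>\<^sub>E V2)
    {h \<in> N \<rightarrow>\<^sub>E V2. \<forall>p\<in>parents (t1, r1) s. h p = r2}"
    (is "bij_betw _ (?K \<rightarrow>\<^sub>E V2) ?H")
proof (rule bij_betw_byWitness[where f' = "\<lambda>h. restrict h ?K"]; intro ballI subsetI)
  note K = children_eq[OF t1 r1, of s]
  fix h assume h: "h \<in> ?K \<rightarrow>\<^sub>E V2"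
  show "restrict (join h) ?K = h"
  proof
    fix n
    show "restrict (join h) ?K n = h n"
      using PiE_arb[OF h, of n] by (cases "n \<in> ?K") (simp_all add: join_def K)
  qed
next
  note K = children_eq[OF t1 r1, of s]
  fix h assume h: "h \<in> ?H"
  then have hE: "h \<in> N \<rightarrow>\<^sub>E V2" by simp
  show "join (restrict h ?K) = h"
  proof
    fix n
    show "join (restrict h ?K) n = h n"
      using PiE_arb[OF hE, of n] h by (cases "n \<in> N") (simp_all add: join_def K)
  qed
next
  note K = children_eq[OF t1 r1, of s]
  fix g assume "g \<in> join ` (?K \<rightarrow>\<^sub>E V2)"
  then obtain h where h: "h \<in> ?K \<rightarrow>\<^sub>E V2" "g = join h" by blast
  have "join h n \<in> V2" if "n \<in> N" for n
    using PiE_mem[OF h(1), of n] r2 that by (simp add: join_def K)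
  then show "g \<in> ?H" using parents_N by (simp add: h(2)) (simp add: join_def)
next
  note K = children_eq[OF t1 r1, of s]
  fix g assume "g \<in> (\<lambda>h. restrict h ?K) ` ?H"
  then show "g \<in> ?K \<rightarrow>\<^sub>E V2" by (auto simp: K)
qed

lemma rooted_graft_join:
  "replace_vertex t1 s t2
    ({{p, r2} |p. p \<in> parents (t1, r1) s} \<union> {{c, h c} |c. c \<in> children (t1, r1) s})
    = graft s t1 t2 (join h)"
proof -
  have "{{p, r2} |p. p \<in> parents (t1, r1) s} \<union> {{c, h c} |c. c \<in> children (t1, r1) s}
      = {{n, join h n} |n. n \<in> N}" (is "?L = ?R")
  proof (intro subset_antisym subsetI)
    fix e assume "e \<in> ?L"
    then consider p where "p \<in> parents (t1, r1) s" "e = {p, r2}"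
      | c where "c \<in> children (t1, r1) s" "e = {c, h c}" by blast
    then have "\<exists>n\<in>N. e = {n, join h n}"
    proof cases
      case 1
      with parents_N have "p \<in> N" "join h p = r2" by (simp_all add: join_def)
      with 1 show ?thesis by (intro bexI[of _ p]) simp_all
    next
      case 2
      then have "c \<in> N" "join h c = h c" by (simp_all add: join_def children_eq[OF t1 r1])
      with 2 show ?thesis by (intro bexI[of _ c]) simp_all
    qed
    then show "e \<in> ?R" by blast
  next
    fix e assume "e \<in> ?R"
    then obtain n where n: "n \<in> N" "e = {n, join h n}" by blast
    show "e \<in> ?L"
    proof (cases "n \<in> parents (t1, r1) s")
      case True
      with n have "e = {n, r2}" by (simp add: join_def)
      with True show ?thesis by blast
    next
      case False
      with n have "e = {n, h n}" "n \<in> children (t1, r1) s"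
        by (simp_all add: join_def children_eq[OF t1 r1])
      then show ?thesis by blast
    qed
  qed
  then show ?thesis by (simp add: graft_def)
qed

text \<open>A walk in \<open>t1\<close> that never leaves \<open>s\<close> and ends elsewhere uses
  only edges that grafting keeps.\<close>

lemma adj_avoiding_graft:
  assumes "(u, v) \<in> (adj_avoiding {s} (edges t1))\<^sup>*" "v \<noteq> s"
  shows "(u, v) \<in> (adj_avoiding V2 (edges (graft s t1 t2 h)))\<^sup>*"
  using assms
proof induction
  case (step y z)
  then have yz: "{y, z} \<in> edges t1" "y \<noteq> s" by (auto simp: adj_avoiding_def)
  then have "y \<in> V1" using simple_graphD(1)[OF T1(2)] T1(1) by blast
  with yz step(4) V(2) have "(y, z) \<in> adj_avoiding V2 (edges (graft s t1 t2 h))"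
    by (auto simp: adj_avoiding_def edges_graft)
  with step yz(2) show ?case by (meson rtrancl.rtrancl_into_rtrancl)
qed simp

text \<open>The path from \<open>r1\<close> to \<open>s\<close> in \<open>t1\<close> arrives through
  the parent \<open>p\<close>; in the graft it enters \<open>V2\<close> along
  \<open>{p, h p}\<close> instead.\<close>

lemma gate_graft:
  assumes h: "h \<in> N \<rightarrow>\<^sub>E V2" and p: "p \<in> parents (t1, r1) s"
  shows "gate V2 (graft s t1 t2 h) r1 = h p"
proof (rule gate_eqI[OF graft_in(1)[OF h]])
  have pN: "p \<in> N" using parents_N[OF p] .
  then have p1: "p \<in> V1" "p \<notin> V2" "h p \<in> V2" "p \<noteq> s" using N_V1[OF pN] V h by auto
  have "(r1, p) \<in> (adj_avoiding V2 (edges (graft s t1 t2 h)))\<^sup>*"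
    using p p1(4) by (intro adj_avoiding_graft) (simp_all add: parents_iff[OF t1 r1])
  moreover have "(p, h p) \<in> adj_avoiding V2 (edges (graft s t1 t2 h))"
    using pN p1 by (auto simp: adj_avoiding_def edges_graft)
  ultimately show "is_gate V2 (graft s t1 t2 h) r1 (h p)"
    using p1(3) by (simp add: is_gate_def rtrancl.rtrancl_into_rtrancl)
qed (use graft_in(2)[OF h] t2 in auto)

text \<open>If the root of \<open>t1\<close> is \<open>s\<close>, the root of the graft lies in
  \<open>V2\<close> and is its own gate, so it equals \<open>r2\<close>, and no parent constrains
  \<open>h\<close>. Otherwise the root stays at \<open>r1\<close> and the gate is the vertex to
  which the parent is attached.\<close>

lemma rooted_graft_iff:
  assumes h: "h \<in> N \<rightarrow>\<^sub>E V2"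
  shows "r \<in> V1 \<union> V2 \<and> gate V2 (graft s t1 t2 h) r = r2 \<and> collapse V2 s r = r1
    \<longleftrightarrow> r = comp_root \<and> (\<forall>p\<in>parents (t1, r1) s. h p = r2)"
proof (cases "r1 = s")
  case True
  have "gate V2 (graft s t1 t2 h) r = r" if "r \<in> V2"
    using graft_in(2)[OF h] t2 is_gate_self[OF that] by (intro gate_eqI[OF graft_in(1)[OF h]]) auto
  moreover have "r \<in> V1 \<union> V2 \<and> collapse V2 s r = s \<longleftrightarrow> r \<in> V2"
    using V(1) by (auto simp: collapse_def)
  ultimately show ?thesis
    using True r2 parents_root[OF t1 r1] by auto
next
  case False
  then obtain p where p: "parents (t1, r1) s = {p}" using parents_singleton[OF t1 r1] by auto
  have "r1 \<in> V1" "r1 \<notin> V2" using r1 False V(2) by auto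
  with False have "r \<in> V1 \<union> V2 \<and> collapse V2 s r = r1 \<longleftrightarrow> r = r1"
    by (auto simp: collapse_def split: if_splits)
  moreover have "gate V2 (graft s t1 t2 h) r1 = h p" using gate_graft[OF h] p by simp
  ultimately show ?thesis using False p by auto
qed

lemma rooted_graft_bij:
  "bij_betw (\<lambda>h. (graft s t1 t2 h, comp_root)) {h \<in> N \<rightarrow>\<^sub>E V2. \<forall>p\<in>parents (t1, r1) s. h p = r2}
    {tr \<in> rooted_trees (V1 \<union> V2). rooted_restr V2 tr = (t2, r2) \<and> rooted_contr V2 s tr = (t1, r1)}"
    (is "bij_betw _ ?H ?S")
  unfolding bij_betw_def
proof (intro conjI subset_antisym subsetI)
  show "inj_on (\<lambda>h. (graft s t1 t2 h, comp_root)) ?H"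
    using graft_inj unfolding inj_on_def by blast
next
  fix x assume "x \<in> (\<lambda>h. (graft s t1 t2 h, comp_root)) ` ?H"
  then obtain h where h: "h \<in> N \<rightarrow>\<^sub>E V2" "\<forall>p\<in>parents (t1, r1) s. h p = r2"
    and x: "x = (graft s t1 t2 h, comp_root)" by blast
  from rooted_graft_iff[OF h(1), of comp_root] h(2) graft_in[OF h(1)] show "x \<in> ?S"
    by (simp add: x rooted_restr_def rooted_contr_def)
next
  fix x assume x: "x \<in> ?S"
  obtain t r where tr: "x = (t, r)" by (cases x)
  with x have t: "t \<in> trees (V1 \<union> V2)" "restr V2 t = t2" "contr V2 s t = t1"
    and r: "r \<in> V1 \<union> V2" "gate V2 t r = r2" "collapse V2 s r = r1"
    by (simp_all add: rooted_restr_def rooted_contr_def)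
  obtain h where h: "h \<in> N \<rightarrow>\<^sub>E V2" "t = graft s t1 t2 h" using graft_surj[OF t] .
  then have "r = comp_root \<and> (\<forall>p\<in>parents (t1, r1) s. h p = r2)"
    using rooted_graft_iff[OF h(1), of r] r by simp
  with h tr show "x \<in> (\<lambda>h. (graft s t1 t2 h, comp_root)) ` ?H" by blast
qed

lemma rooted_tree_comp_eq:
  "rooted_tree_comp s (t1, r1) (t2, r2) = (\<Sum>tr | tr \<in> rooted_trees (V1 \<union> V2) \<and>
     rooted_restr V2 tr = (t2, r2) \<and> rooted_contr V2 s tr = (t1, r1). basis tr)"
  unfolding rooted_tree_comp_def split T2(1)
  using sum.reindex_bij_betw[OF bij_betw_trans[OF join_bij rooted_graft_bij], of basis]
  by (simp add: rooted_graft_join)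

end

text \<open>The gate lies in \<open>W\<close> as soon as the restriction is a tree, so conditions on
  rooted restrictions reduce to conditions on trees.\<close>

lemma rooted_restr_in:
  assumes "t \<in> trees V" "r \<in> V" "W \<subseteq> V"
  shows "rooted_restr W (t, r) \<in> rooted_trees W \<longleftrightarrow> restr W t \<in> trees W"
  using is_gate_gate[OF assms(1,3) _ assms(2)] by (auto simp: rooted_restr_def is_gate_def)

text \<open>On the underlying trees the laws are already known, and what remains concerns roots.
  Contraction moves the root by \<open>collapse\<close>; for restrictions, a candidate is shown to
  be a gate and then identified by uniqueness.\<close>

interpretation PLie: restriction_contraction rooted_trees rooted_restr rooted_contr map_rgraph
  "\<lambda>v. (({v}, {}), v)"
  "rooted_tree_comp :: 'a \<Rightarrow> 'a rgraph \<Rightarrow> 'a rgraph \<Rightarrow> ('a rgraph \<Rightarrow>\<^sub>0 'k::field_char_0)"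
proof
  show "rooted_trees {} = {}" by (auto simp: rooted_trees_def)
  show "finite (rooted_trees V)" if "finite V" for V :: "'a set"
    using finite_trees[OF that] that finite_subset[of "rooted_trees V" "trees V \<times> V"]
    by (auto simp: rooted_trees_def)
  show "(({v}, {}), v) \<in> rooted_trees {v}" for v :: 'a by (simp add: single_vertex_tree)
  show "map_rgraph \<sigma> (({v}, {}), v) = (({\<sigma> v}, {}), \<sigma> v)" for \<sigma> :: "'a \<Rightarrow> 'a" and v
    by (simp add: map_rgraph_def map_graph_def)
  show "map_rgraph (\<lambda>v. v) tr = tr" for tr :: "'a rgraph" by (simp add: map_rgraph_def split: prod.split)
  show "map_rgraph (\<lambda>v. \<tau> (\<sigma> v)) tr = map_rgraph \<tau> (map_rgraph \<sigma> tr)"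
    for tr :: "'a rgraph" and \<sigma> \<tau> :: "'a \<Rightarrow> 'a"
    by (simp add: map_rgraph_def map_graph_comp split: prod.split)
next
  fix V1 V2 s and tr1 tr2 :: "'a rgraph"
  assume a: "s \<notin> V1" "V1 \<inter> V2 = {}" "tr1 \<in> rooted_trees (insert s V1)" "tr2 \<in> rooted_trees V2"
  obtain t1 r1 t2 r2 where tr: "tr1 = (t1, r1)" "tr2 = (t2, r2)" by (cases tr1, cases tr2)
  with a interpret rooted_tree_pair V1 V2 s t1 t2 r1 r2 by unfold_locales auto
  show "rooted_tree_comp s tr1 tr2 = (\<Sum>tr | tr \<in> rooted_trees (V1 \<union> V2) \<and>
      rooted_restr V2 tr = tr2 \<and> rooted_contr V2 s tr = tr1. basis tr)"
    unfolding tr by (rule rooted_tree_comp_eq)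
next
  fix V W and tr :: "'a rgraph" and \<sigma> \<tau> :: "'a \<Rightarrow> 'a" and s s'
  assume "tr \<in> rooted_trees V"
  then obtain t r where tr: "tr = (t, r)" and t: "t \<in> trees V" and r: "r \<in> V"
    by (auto simp: rooted_trees_def)
  note T = treesD[OF t]
  show "map_rgraph \<sigma> tr = map_rgraph \<tau> tr" if "\<And>v. v \<in> V \<Longrightarrow> \<sigma> v = \<tau> v"
    using T.rel_cong[OF t, of \<sigma> \<tau>] that r by (simp add: tr map_rgraph_def)
  show "map_rgraph \<sigma> tr \<in> rooted_trees (\<sigma> ` V)" if "inj_on \<sigma> V"
    using map_graph_tree[OF t that] r by (simp add: tr map_rgraph_def)
  show "rooted_restr (\<sigma> ` W) (map_rgraph \<sigma> tr) = map_rgraph \<sigma> (rooted_restr W tr)"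
    if W: "W \<subseteq> V" and \<sigma>: "inj_on \<sigma> V" and "rooted_restr W tr \<in> rooted_trees W"
  proof -
    have rW: "restr W t \<in> trees W" using that(3) rooted_restr_in[OF t r W] tr by simp
    have eq: "restr (\<sigma> ` W) (map_graph \<sigma> t) = map_graph \<sigma> (restr W t)"
      using T.res_rel[OF t W \<sigma> rW] .
    have "is_gate (\<sigma> ` W) (map_graph \<sigma> t) (\<sigma> r) (\<sigma> (gate W t r))"
      using is_gate_map[OF T(2)] is_gate_gate[OF t W rW r] T(1) W \<sigma> by simp
    moreover have "map_graph \<sigma> (restr W t) \<in> trees (\<sigma> ` W)"
      using rW inj_on_subset[OF \<sigma> W] by (rule map_graph_tree)
    ultimately have "gate (\<sigma> ` W) (map_graph \<sigma> t) (\<sigma> r) = \<sigma> (gate W t r)"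
      using map_graph_tree[OF t \<sigma>] W eq by (intro gate_eqI[of _ "\<sigma> ` V"]) auto
    with eq show ?thesis by (simp add: tr map_rgraph_def rooted_restr_def)
  qed
  show "rooted_contr (\<sigma> ` W) s' (map_rgraph \<sigma> tr) = map_rgraph \<tau> (rooted_contr W s tr)"
    if "W \<subseteq> V" "inj_on \<sigma> V" "\<And>v. v \<in> V - W \<Longrightarrow> \<tau> v = \<sigma> v" "\<tau> s = s'"
    using T.con_rel[OF t that] collapse_map[OF that(2,1) r that(3,4)]
    by (simp add: tr map_rgraph_def rooted_contr_def)
  have all: "restr V t = t" using T.res_all[OF t] .
  then have "gate V t r = r" using t is_gate_self[OF r] by (intro gate_eqI[OF t]) auto
  with all show "rooted_restr V tr = tr" by (simp add: tr rooted_restr_def)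
  show "rooted_contr V s tr = (({s}, {}), s)"
    using T.con_all[OF t] r by (simp add: tr rooted_contr_def)
  show "rooted_restr {v} tr = (({v}, {}), v)" if "v \<in> V" for v
  proof -
    have v: "restr {v} t = ({v}, {})" using restr_singleton[OF T(2)] .
    then have "is_gate {v} t r (gate {v} t r)"
      using is_gate_gate[OF t _ _ r, of "{v}"] that single_vertex_tree[of v] by simp
    with v show ?thesis by (simp add: tr rooted_restr_def is_gate_def)
  qed
  show "rooted_contr {v} s tr = map_rgraph (\<lambda>u. if u = v then s else u) tr" if "v \<in> V" for v
    using T.con_singleton[OF t that] by (simp add: tr rooted_contr_def map_rgraph_def collapse_def)
next
  fix V W W' and tr :: "'a rgraph" and s s'
  assume "tr \<in> rooted_trees V"
  then obtain t r where tr: "tr = (t, r)" and t: "t \<in> trees V" and r: "r \<in> V"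
    by (auto simp: rooted_trees_def)
  note T = treesD[OF t]
  have res_iff: "rooted_restr U tr \<in> rooted_trees U \<longleftrightarrow> restr U t \<in> trees U" if "U \<subseteq> V" for U
    using rooted_restr_in[OF t r that] tr by simp
  have con_in: "contr U a t \<in> trees (insert a (V - U))" "collapse U a r \<in> insert a (V - U)"
    if "U \<subseteq> V" "a \<notin> V - U" "restr U t \<in> trees U" for U a
    using contr_tree(1)[OF t that(1,3,2)] r by (auto simp: collapse_def)
  show "rooted_contr W s tr \<in> rooted_trees (insert s (V - W))"
    if "W \<subseteq> V" "s \<notin> V - W" "rooted_restr W tr \<in> rooted_trees W"
    using con_in[OF that(1,2)] res_iff that by (simp add: tr rooted_contr_def)
  show "rooted_restr W tr \<in> rooted_trees W"
    if W: "W' \<subseteq> W" "W \<subseteq> V" and s': "s' \<notin> V - W'" and "rooted_restr W' tr \<in> rooted_trees W'"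
      and "rooted_restr (insert s' (W - W')) (rooted_contr W' s' tr) \<in> rooted_trees (insert s' (W - W'))"
  proof -
    have "W' \<subseteq> V" using W by blast
    moreover from this have "restr W' t \<in> trees W'" using res_iff that(4) by blast
    moreover have "restr (insert s' (W - W')) (contr W' s' t) \<in> trees (insert s' (W - W'))"
      using that(5) by (simp add: tr rooted_contr_def rooted_restr_def)
    ultimately show ?thesis using T.res_B[OF t W s'] res_iff[OF W(2)] by blast
  qed
  show "rooted_restr W' (rooted_restr W tr) = rooted_restr W' tr"
    if W: "W' \<subseteq> W" "W \<subseteq> V" and "rooted_restr W tr \<in> rooted_trees W"
      and or: "rooted_restr W' tr \<in> rooted_trees W' \<or> rooted_restr W' (rooted_restr W tr) \<in> rooted_trees W'"
  proof -
    have W': "W' \<subseteq> V" using W by blast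
    have rW: "restr W t \<in> trees W" using that(3) res_iff W by blast
    have rr: "restr W' (restr W t) = restr W' t" using W(1) by (rule restr_restr)
    \<comment> \<open>Either disjunct gives this, as the two underlying graphs agree; with it both
      gates are well defined and can be compared.\<close>
    have rW': "restr W' t \<in> trees W'"
      using or res_iff[OF W'] rr by (auto simp: tr rooted_restr_def)
    have g: "is_gate W t r (gate W t r)" using is_gate_gate[OF t W(2) rW r] .
    then have "is_gate W' (restr W t) (gate W t r) (gate W' (restr W t) (gate W t r))"
      using is_gate_gate[OF rW W(1)] rW' rr by (simp add: is_gate_def)
    then have "gate W' t r = gate W' (restr W t) (gate W t r)"
      using is_gate_restr[OF W(1) g] gate_eqI[OF t W' rW'] by blast
    with rr show ?thesis by (simp add: tr rooted_restr_def)
  qed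
  show "rooted_contr W' s' (rooted_restr W tr) = rooted_restr (insert s' (W - W')) (rooted_contr W' s' tr)"
    if W: "W' \<subseteq> W" "W \<subseteq> V" and s': "s' \<notin> V - W'" and "rooted_restr W tr \<in> rooted_trees W"
      and "rooted_restr W' tr \<in> rooted_trees W'"
  proof -
    have W': "W' \<subseteq> V" using W by blast
    have rW: "restr W t \<in> trees W" "restr W' t \<in> trees W'" using that(4,5) res_iff W W' by blast+
    have cr: "contr W' s' (restr W t) = restr (insert s' (W - W')) (contr W' s' t)"
      using T.con_res[OF t W s' rW] .
    have "s' \<notin> W - W'" using s' W by blast
    then have "contr W' s' (restr W t) \<in> trees (insert s' (W - W'))"
      using contr_tree(1)[OF rW(1) W(1), of s'] rW(2) restr_restr[OF W(1)] by simp
    moreover have "is_gate (insert s' (W - W')) (contr W' s' t) (collapse W' s' r)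
        (collapse W' s' (gate W t r))"
      using is_gate_contr[OF T(2) _ W(1) is_gate_gate[OF t W(2) rW(1) r]] s' T(1) by simp
    ultimately have "gate (insert s' (W - W')) (contr W' s' t) (collapse W' s' r)
        = collapse W' s' (gate W t r)"
      using con_in(1)[OF W' s' rW(2)] cr W by (intro gate_eqI) auto
    with cr show ?thesis by (simp add: tr rooted_restr_def rooted_contr_def)
  qed
  show "rooted_contr (insert s' (W - W')) s (rooted_contr W' s' tr) = rooted_contr W s tr"
    if W: "W' \<subseteq> W" "W \<subseteq> V" and s': "s' \<notin> V - W'"
  proof -
    have "collapse (insert s' (W - W')) s (collapse W' s' r) = collapse W s r"
      using W s' r by (auto simp: collapse_def)
    with T.con_con[OF t W s'] show ?thesis by (simp add: tr rooted_contr_def)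
  qed
  show "rooted_restr W (rooted_contr W' s' tr) = rooted_restr W tr"
    if W: "W \<subseteq> V" "W' \<subseteq> V" "W' \<inter> W = {}" and s': "s' \<notin> V - W'"
      and "rooted_restr W' tr \<in> rooted_trees W'"
      and or: "rooted_restr W tr \<in> rooted_trees W \<or> rooted_restr W (rooted_contr W' s' tr) \<in> rooted_trees W"
  proof -
    have rW': "restr W' t \<in> trees W'" using that(5) res_iff W by blast
    have sW: "s' \<notin> W" using s' W by blast
    have rc: "restr W (contr W' s' t) = restr W t" using restr_contr[OF T(2) W(3) sW] .
    then have rW: "restr W t \<in> trees W"
      using or res_iff[OF W(1)] by (auto simp: tr rooted_restr_def rooted_contr_def)
    have "is_gate W (contr W' s' t) (collapse W' s' r) (gate W t r)"
      using is_gate_contr_disjoint[OF T(2) sW W(3) is_gate_gate[OF t W(1) rW r]] .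
    then have "gate W (contr W' s' t) (collapse W' s' r) = gate W t r"
      using con_in(1)[OF W(2) s' rW'] rc rW W by (intro gate_eqI[of _ "insert s' (V - W')"]) auto
    with rc show ?thesis by (simp add: tr rooted_restr_def rooted_contr_def)
  qed
  show "rooted_contr W s (rooted_contr W' s' tr) = rooted_contr W' s' (rooted_contr W s tr)"
    if "W' \<inter> W = {}" "s' \<notin> W" "s \<notin> W'" "s \<noteq> s'"
  proof -
    have "collapse W s (collapse W' s' r) = collapse W' s' (collapse W s r)"
      using that by (auto simp: collapse_def)
    with contr_commute[OF that] show ?thesis by (simp add: tr rooted_contr_def)
  qed
qed

lemma PLie_operad_eq: "PLie_operad = PLie.P"
  by (simp add: PLie_operad_def PLie.P_def)

section \<open>The monomorphism\<close>

lemma \<psi>_pcomp_trees: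
  fixes t1 t2 :: "'a graph"
  assumes V: "finite V1" "finite V2" "s \<notin> V1" "V1 \<inter> V2 = {}"
    and t: "t1 \<in> trees (insert s V1)" "t2 \<in> trees V2"
  shows "(\<psi> (V1 \<union> V2) (tree_comp s t1 t2) :: 'a rgraph \<Rightarrow>\<^sub>0 'k::field_char_0)
    = bilin_ext (rooted_tree_comp s) (\<Sum>r\<in>insert s V1. basis (t1, r)) (\<Sum>r\<in>V2. basis (t2, r))"
    (is "_ = ?R")
proof -
  let ?C = "{t \<in> trees (V1 \<union> V2). restr V2 t = t2 \<and> contr V2 s t = t1}"
  have finC: "finite ?C" using V finite_trees[of "V1 \<union> V2"] by simp
  have "?R = (\<Sum>r1\<in>insert s V1. \<Sum>r2\<in>V2. rooted_tree_comp s (t1, r1) (t2, r2))"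
    by (simp only: bilin_ext_sum bilin_ext_basis) (rule sum.swap)
  also have "\<dots> = (\<Sum>u\<in>insert s V1 \<times> V2. rooted_tree_comp s (t1, fst u) (t2, snd u))"
    by (simp only: sum.cartesian_product case_prod_unfold)
  also have "\<dots> = (\<Sum>tr\<in>?C \<times> (V1 \<union> V2). basis tr)"
  proof (rule sum_fibres[where g = "\<lambda>(t, r). (collapse V2 s r, gate V2 t r)"])
    show "(\<lambda>(t, r). (collapse V2 s r, gate V2 t r)) ` (?C \<times> (V1 \<union> V2)) \<subseteq> insert s V1 \<times> V2"
    proof clarify
      fix T r assume tr: "T \<in> trees (V1 \<union> V2)" "r \<in> V1 \<union> V2" "t2 = restr V2 T"
      then have "is_gate V2 T r (gate V2 T r)" using t(2) by (intro is_gate_gate) auto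
      with tr show "collapse V2 s r \<in> insert s V1 \<and> gate V2 T r \<in> V2"
        by (auto simp: collapse_def is_gate_def)
    qed
    fix u assume u: "u \<in> insert s V1 \<times> V2"
    \<comment> \<open>A fibre consists of the composites for one pair of roots, where
      \<open>u\<close> lists the root of \<open>t1\<close> and then that of
      \<open>t2\<close>.\<close>
    have "{tr \<in> ?C \<times> (V1 \<union> V2). (case tr of (t, r) \<Rightarrow> (collapse V2 s r, gate V2 t r)) = u}
        = {tr \<in> rooted_trees (V1 \<union> V2). rooted_restr V2 tr = (t2, snd u) \<and> rooted_contr V2 s tr = (t1, fst u)}"
      by (auto simp: rooted_trees_def rooted_restr_def rooted_contr_def)
    moreover have "(rooted_tree_comp s (t1, fst u) (t2, snd u) :: 'a rgraph \<Rightarrow>\<^sub>0 'k)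
        = (\<Sum>tr | tr \<in> rooted_trees (V1 \<union> V2) \<and> rooted_restr V2 tr = (t2, snd u) \<and>
            rooted_contr V2 s tr = (t1, fst u). basis tr)"
      using t u by (intro PLie.cmp_eq[OF V]) auto
    ultimately show "(rooted_tree_comp s (t1, fst u) (t2, snd u) :: 'a rgraph \<Rightarrow>\<^sub>0 'k) = (\<Sum>tr\<in>{tr \<in> ?C \<times> (V1 \<union> V2).
        (case tr of (t, r) \<Rightarrow> (collapse V2 s r, gate V2 t r)) = u}. basis tr)"
      by simp
  qed (use V finC in auto)
  also have "\<dots> = (\<Sum>t\<in>?C. \<Sum>r\<in>V1 \<union> V2. basis (t, r))"
    by (simp only: sum.cartesian_product case_prod_unfold prod.collapse)
  also have "\<dots> = \<psi> (V1 \<union> V2) (tree_comp s t1 t2)"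
    by (simp add: T.cmp_eq[OF V t] \<psi>_def lin_ext_sum)
  finally show ?thesis ..
qed

lemma \<psi>_left_inverse:
  assumes "finite V" "r \<in> V"
  shows "lin_ext (\<lambda>(t, r'). if r' = r then basis t else 0) (\<psi> V x) = x"
proof -
  have "x \<in> free_on UNIV" by (simp add: free_on_def)
  then show ?thesis
    by (induction rule: free_on_induct) (use assms in \<open>auto simp: \<psi>_def lin_ext_sum\<close>)
qed

theorem proposition2p3:
  shows "operad_monomorphism
    (T_operad :: ('a, 'k::field_char_0, 'a graph \<Rightarrow>\<^sub>0 'k) operad_data)
    (PLie_operad :: ('a, 'k, 'a rgraph \<Rightarrow>\<^sub>0 'k) operad_data)
    \<psi>"
proof (intro operad_monomorphism.intro operad_morphism.intro operad_morphism_axioms.intro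
    operad_monomorphism_axioms.intro)
  show "operad (T_operad :: ('a, 'k, 'a graph \<Rightarrow>\<^sub>0 'k) operad_data)"
    unfolding T_operad_eq by (rule T.operad_P)
  show "operad (PLie_operad :: ('a, 'k, 'a rgraph \<Rightarrow>\<^sub>0 'k) operad_data)"
    unfolding PLie_operad_eq by (rule PLie.operad_P)
next
  fix V and x :: "'a graph \<Rightarrow>\<^sub>0 'k"
  assume "x \<in> space T_operad V"
  then have "x \<in> free_on (trees V)" by (simp add: T_operad_def)
  then have "\<psi> V x \<in> free_on (rooted_trees V)"
    unfolding \<psi>_def by (rule lin_ext_in) (intro free.subspace_sum subspace_free_on, simp)
  then show "\<psi> V x \<in> space PLie_operad V" by (simp add: PLie_operad_def)
next
  fix V :: "'a set"
  show "linear_map_on (smult T_operad) (smult PLie_operad) (space T_operad V)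
      (\<psi> V :: ('a graph \<Rightarrow>\<^sub>0 'k) \<Rightarrow> _)"
    by (simp add: linear_map_on_def T_operad_def PLie_operad_def \<psi>_def)
next
  fix V and \<sigma> :: "'a \<Rightarrow> 'a" and x :: "'a graph \<Rightarrow>\<^sub>0 'k"
  assume \<sigma>: "inj_on \<sigma> V" and "x \<in> space T_operad V"
  then have "x \<in> free_on (trees V)" by (simp add: T_operad_def)
  then have "\<psi> (\<sigma> ` V) (lin_ext (\<lambda>t. basis (map_graph \<sigma> t)) x)
      = lin_ext (\<lambda>t. basis (map_rgraph \<sigma> t)) (\<psi> V x)"
    by (induction rule: free_on_induct)
      (auto simp: \<psi>_def lin_ext_sum map_rgraph_def sum.reindex[OF \<sigma>])
  then show "\<psi> (\<sigma> ` V) (relabel T_operad V \<sigma> x) = relabel PLie_operad V \<sigma> (\<psi> V x)"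
    by (simp add: T_operad_def PLie_operad_def)
next
  fix v :: 'a
  show "\<psi> {v} (op_unit T_operad v :: 'a graph \<Rightarrow>\<^sub>0 'k) = op_unit PLie_operad v"
    by (simp add: T_operad_def PLie_operad_def \<psi>_def)
next
  fix V1 V2 s and x y :: "'a graph \<Rightarrow>\<^sub>0 'k"
  assume V: "finite V1" "finite V2" "s \<notin> V1" "V1 \<inter> V2 = {}"
    and "x \<in> space T_operad (insert s V1)" "y \<in> space T_operad V2"
  then have "x \<in> free_on (trees (insert s V1))" and y: "y \<in> free_on (trees V2)"
    by (simp_all add: T_operad_def)
  then have "\<psi> (V1 \<union> V2) (bilin_ext (tree_comp s) x y)
      = bilin_ext (rooted_tree_comp s) (\<psi> (insert s V1) x) (\<psi> V2 y)"
  proof (induction x rule: free_on_induct)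
    case a: (basis a)
    from y show ?case
    proof (induction y rule: free_on_induct)
      case b: (basis b)
      show ?case using \<psi>_pcomp_trees[OF V a(1) b] by (simp add: \<psi>_def)
    qed (simp_all add: \<psi>_def)
  qed (simp_all add: \<psi>_def)
  then show "\<psi> (V1 \<union> V2) (pcomp T_operad V1 s V2 x y)
      = pcomp PLie_operad V1 s V2 (\<psi> (insert s V1) x) (\<psi> V2 y)"
    by (simp add: T_operad_def PLie_operad_def)
next
  fix V :: "'a set" assume V: "finite V"
  show "inj_on (\<psi> V) (space (T_operad :: ('a, 'k, 'a graph \<Rightarrow>\<^sub>0 'k) operad_data) V)"
  \<comment> \<open>The left inverse keeps the summand at one chosen root. The empty set has no
    vertex to choose, but there the space of trees is zero.\<close>
  proof (cases "V = {}")
    case True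
    then show ?thesis by (simp add: T_operad_def T.B_empty)
  next
    case False
    then obtain r where "r \<in> V" by blast
    from \<psi>_left_inverse[OF V this] show ?thesis by (rule inj_on_inverseI)
  qed
qed

end
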